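(* Let $u_0\in C(0,1)$ take values in $[0,1]$ and let $v_{0,-},v_{0,+}\in[0,1]$. Then there exists a unique bounded function $u\in C^{2,1}([0,1]\times(0,\infty))$ such that $$u_t=\tfrac12u_{rr}\ \text{ on } (0,1)\times(0,\infty),\qquad \lim_{t\downarrow0}u(r,t)=u_0(r)\ \text{ for } r\in(0,1),$$ and such that the functions $v_-(t):=u(0,t)$ and $v_+(t):=u(1,t)$ satisfy, for every $t>0$, $$\frac{d}{dt}v_-(t)=\tfrac12u_r(0,t),\qquad \frac{d}{dt}v_+(t)=-\tfrac12u_r(1,t),$$ and $$\lim_{t\downarrow0}v_-(t)=v_{0,-},\qquad \lim_{t\downarrow0}v_+(t)=v_{0,+}.$$
   Context: $C^{2,1}([0,1]\times(0,\infty))$ is the set of real functions $u(r,t)$ on $[0,1]\times(0,\infty)$ that are twice continuously differentiable in $r$ and once continuously differentiable in $t$, up to and including the boundary points $r=0$ and $r=1$ (with one-sided $r$-derivatives there). Subscripts $r,t$ denote partial derivatives. *)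

theory Defs
  imports "HOL-Analysis.Analysis"
begin

definition heat_domain :: "(real \<times> real) set" where
  "heat_domain = {0..1} \<times> {0<..}"

(* The derivative is taken within [0,1]: two-sided for 0 < r < 1, one-sided at r = 0 and r = 1. *)
definition partial_r :: "(real \<Rightarrow> real \<Rightarrow> real) \<Rightarrow> real \<Rightarrow> real \<Rightarrow> real" where
  "partial_r u r t = vector_derivative (\<lambda>x. u x t) (at r within {0..1})"

definition partial_t :: "(real \<Rightarrow> real \<Rightarrow> real) \<Rightarrow> real \<Rightarrow> real \<Rightarrow> real" where
  "partial_t u r t = deriv (\<lambda>s. u r s) t"

(* C^{2,1}([0,1] x (0,oo)). Continuity is joint in (r,t). Functions are total in HOL; only the
   values on heat_domain matter. *)
definition C21 :: "(real \<Rightarrow> real \<Rightarrow> real) set" where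
  "C21 = {u.
     (\<forall>r\<in>{0..1}. \<forall>t>0.
        (\<lambda>x. u x t) differentiable (at r within {0..1}) \<and>
        (\<lambda>x. partial_r u x t) differentiable (at r within {0..1}) \<and>
        (\<lambda>s. u r s) differentiable (at t)) \<and>
     continuous_on heat_domain (\<lambda>(r, t). u r t) \<and>
     continuous_on heat_domain (\<lambda>(r, t). partial_r u r t) \<and>
     continuous_on heat_domain (\<lambda>(r, t). partial_r (partial_r u) r t) \<and>
     continuous_on heat_domain (\<lambda>(r, t). partial_t u r t)}"

definition is_bounded_solution ::
  "(real \<Rightarrow> real) \<Rightarrow> real \<Rightarrow> real \<Rightarrow> (real \<Rightarrow> real \<Rightarrow> real) \<Rightarrow> bool" where
  "is_bounded_solution u0 v0_minus v0_plus u \<longleftrightarrow>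
     u \<in> C21 \<and>
     bounded ((\<lambda>(r, t). u r t) ` heat_domain) \<and>
     (\<forall>r\<in>{0<..<1}. \<forall>t>0. partial_t u r t = 1/2 * partial_r (partial_r u) r t) \<and>
     (\<forall>r\<in>{0<..<1}. ((\<lambda>t. u r t) \<longlongrightarrow> u0 r) (at_right 0)) \<and>
     (let v_minus = (\<lambda>t. u 0 t); v_plus = (\<lambda>t. u 1 t) in
       (\<forall>t>0. (v_minus has_real_derivative 1/2 * partial_r u 0 t) (at t)) \<and>
       (\<forall>t>0. (v_plus has_real_derivative - (1/2) * partial_r u 1 t) (at t)) \<and>
       (v_minus \<longlongrightarrow> v0_minus) (at_right 0) \<and>
       (v_plus \<longlongrightarrow> v0_plus) (at_right 0))"

end

theory Submission
  imports Defs "HOL-Probability.Distributions"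
begin

text \<open>
  Existence: on the boundary the heat equation turns the dynamic condition into
  \<open>u_rr = u_r\<close> at 0 and \<open>u_rr = - u_r\<close> at 1. The solution is the Gaussian convolution of an
  extension F of the initial function to the whole line for which \<open>F'' - F'\<close> is odd about 0 and
  \<open>F'' + F'\<close> is odd about 1 in the distributional sense. Integrating twice, the condition at 0 becomes
  \<open>F (- y) = - F y + 2 exp (- y) (v + \<integral>\<^sub>0\<^sup>y exp s F s ds)\<close> for y > 0, which involves no derivative of
  F; the integration constant v is the boundary value, as the mean of F y and F (- y) tends to v.
  Alternating reflections at 0 and 1 define F off the integers, with exponential growth.

  Uniqueness and boundedness: for \<open>\<phi> x = (max 0 x)\<^sup>3\<close>, the energy
  \<open>\<integral>\<^sub>0\<^sup>1 \<phi> (u r t) dr + \<phi> (u 0 t) + \<phi> (u 1 t)\<close> is nonincreasing in t, because its derivative is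
  \<open>- 1/2 \<integral>\<^sub>0\<^sup>1 \<phi>'' (u) (u_r)\<^sup>2 dr\<close>. By dominated convergence it tends to 0 as t decreases to 0 if u is
  bounded with nonpositive initial values. Only pointwise initial convergence is needed.
\<close>

subsection \<open>Comparison principle for the dynamic boundary value problem\<close>

text \<open>The derivatives \<open>p\<close>, \<open>q\<close>, \<open>s\<close> are arguments, so
  that explicit formulas and differences of solutions are handled without evaluating
  \<open>partial_r\<close> or \<open>partial_t\<close>. Initial values and boundedness are left out;
  what remains is linear and admits the constants.\<close>

definition wentzell_solution ::
  "(real \<Rightarrow> real \<Rightarrow> real) \<Rightarrow> (real \<Rightarrow> real \<Rightarrow> real) \<Rightarrow> (real \<Rightarrow> real \<Rightarrow> real) \<Rightarrow>
    (real \<Rightarrow> real \<Rightarrow> real) \<Rightarrow> bool" where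
  "wentzell_solution w p q s \<longleftrightarrow>
     (\<forall>r\<in>{0..1}. \<forall>t>0.
        ((\<lambda>x. w x t) has_real_derivative p r t) (at r within {0..1}) \<and>
        ((\<lambda>x. p x t) has_real_derivative q r t) (at r within {0..1}) \<and>
        (w r has_real_derivative s r t) (at t)) \<and>
     continuous_on heat_domain (\<lambda>(r, t). w r t) \<and>
     continuous_on heat_domain (\<lambda>(r, t). p r t) \<and>
     continuous_on heat_domain (\<lambda>(r, t). q r t) \<and>
     continuous_on heat_domain (\<lambda>(r, t). s r t) \<and>
     (\<forall>t>0. (\<forall>r\<in>{0<..<1}. s r t = 1/2 * q r t) \<and> s 0 t = 1/2 * p 0 t \<and> s 1 t = - (1/2) * p 1 t)"

lemma wentzell_solutionD:
  assumes "wentzell_solution w p q s"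
  shows "\<And>r t. \<lbrakk>0 \<le> r; r \<le> 1; t > 0\<rbrakk> \<Longrightarrow> ((\<lambda>x. w x t) has_real_derivative p r t) (at r within {0..1})"
    and "\<And>r t. \<lbrakk>0 \<le> r; r \<le> 1; t > 0\<rbrakk> \<Longrightarrow> ((\<lambda>x. p x t) has_real_derivative q r t) (at r within {0..1})"
    and "\<And>r t. \<lbrakk>0 \<le> r; r \<le> 1; t > 0\<rbrakk> \<Longrightarrow> (w r has_real_derivative s r t) (at t)"
    and "continuous_on heat_domain (\<lambda>(r, t). w r t)"
    and "continuous_on heat_domain (\<lambda>(r, t). p r t)"
    and "continuous_on heat_domain (\<lambda>(r, t). q r t)"
    and "continuous_on heat_domain (\<lambda>(r, t). s r t)"
    and "\<And>r t. \<lbrakk>0 < r; r < 1; t > 0\<rbrakk> \<Longrightarrow> s r t = 1/2 * q r t"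
    and "\<And>t. t > 0 \<Longrightarrow> s 0 t = 1/2 * p 0 t"
    and "\<And>t. t > 0 \<Longrightarrow> s 1 t = - (1/2) * p 1 t"
  using assms unfolding wentzell_solution_def by auto

lemma wentzell_solution_diff:
  assumes "wentzell_solution w p q s" "wentzell_solution w' p' q' s'"
  shows "wentzell_solution (\<lambda>r t. w r t - w' r t) (\<lambda>r t. p r t - p' r t)
           (\<lambda>r t. q r t - q' r t) (\<lambda>r t. s r t - s' r t)"
proof -
  note A = wentzell_solutionD[OF assms(1)] and B = wentzell_solutionD[OF assms(2)]
  have D: "continuous_on heat_domain (\<lambda>(r, t). f r t - g r t)"
    if "continuous_on heat_domain (\<lambda>(r, t). f r t)" "continuous_on heat_domain (\<lambda>(r, t). g r t)"
    for f g :: "real \<Rightarrow> real \<Rightarrow> real"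
    using continuous_on_diff[OF that] by (simp add: case_prod_unfold)
  show ?thesis
    unfolding wentzell_solution_def
    using A B
    by (auto intro!: D DERIV_diff simp: field_simps)
qed

lemma wentzell_solution_const: "wentzell_solution (\<lambda>r t. c) (\<lambda>r t. 0) (\<lambda>r t. 0) (\<lambda>r t. 0)"
  unfolding wentzell_solution_def by (auto intro!: continuous_intros derivative_eq_intros)

text \<open>Differentiability makes the chosen derivatives genuine ones; at the endpoints the
  prescribed time derivative is \<open>partial_t\<close> by uniqueness of derivatives.\<close>

lemma is_bounded_solution_imp_wentzell:
  assumes "is_bounded_solution u0 v0 v1 u"
  shows "wentzell_solution u (partial_r u) (partial_r (partial_r u)) (partial_t u)"
proof -
  have 1: "((\<lambda>x. w x t) has_real_derivative partial_r w r t) (at r within {0..1})"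
    if "(\<lambda>x. w x t) differentiable (at r within {0..1})" for w r t
    using that
    by (simp add: partial_r_def has_real_derivative_iff_has_vector_derivative vector_derivative_works[symmetric])
  have 2: "(u r has_real_derivative partial_t u r t) (at t)"
    if "(\<lambda>s. u r s) differentiable (at t)" for r t
    using that DERIV_deriv_iff_real_differentiable by (simp add: partial_t_def)
  have 3: "partial_t u r t = d" if "(u r has_real_derivative d) (at t)" for r t d
    using DERIV_imp_deriv[OF that] by (simp add: partial_t_def)
  have "partial_t u 0 t = 1/2 * partial_r u 0 t" "partial_t u 1 t = - (1/2) * partial_r u 1 t"
    if "t > 0" for t
    using assms that unfolding is_bounded_solution_def Let_def by (blast intro: 3)+
  then show ?thesis
    using assms
    unfolding wentzell_solution_def is_bounded_solution_def C21_def Let_def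
    by (auto intro!: 1 2)
qed

lemma wentzell_imp_is_bounded_solution:
  assumes sol: "wentzell_solution u p q s"
    and bdd: "bounded ((\<lambda>(r, t). u r t) ` heat_domain)"
    and init: "\<And>r. 0 < r \<Longrightarrow> r < 1 \<Longrightarrow> (u r \<longlongrightarrow> u0 r) (at_right 0)"
    and v0: "(u 0 \<longlongrightarrow> v0) (at_right 0)" and v1: "(u 1 \<longlongrightarrow> v1) (at_right 0)"
  shows "is_bounded_solution u0 v0 v1 u"
proof -
  note A = wentzell_solutionD[OF sol]
  have pr: "partial_r w r t = d"
    if "((\<lambda>x. w x t) has_real_derivative d) (at r within {0..1})" "0 \<le> r" "r \<le> 1" for w r t d
    using that vector_derivative_within_closed_interval[of 0 1 r "\<lambda>x. w x t" d]
    by (simp add: partial_r_def has_real_derivative_iff_has_vector_derivative)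
  have p: "partial_r u r t = p r t" if "0 \<le> r" "r \<le> 1" "t > 0" for r t
    using that A(1) pr by blast
  \<comment> \<open>\<open>partial_r u\<close> is known to agree with \<open>p\<close> only on
    [0,1], which suffices because the derivative is taken within that interval.\<close>
  have dp: "((\<lambda>x. partial_r u x t) has_real_derivative q r t) (at r within {0..1})"
    if "0 \<le> r" "r \<le> 1" "t > 0" for r t
    by (rule has_field_derivative_transform_within[OF A(2) zero_less_one]) (use that p in auto)
  have q: "partial_r (partial_r u) r t = q r t" if "0 \<le> r" "r \<le> 1" "t > 0" for r t
    using that dp pr by blast
  have s: "partial_t u r t = s r t" if "0 \<le> r" "r \<le> 1" "t > 0" for r t
    unfolding partial_t_def using that A(3) DERIV_imp_deriv by blast
  have cong: "continuous_on heat_domain (\<lambda>(r, t). f r t)"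
    if "continuous_on heat_domain (\<lambda>(r, t). g r t)"
       "\<And>r t. \<lbrakk>0 \<le> r; r \<le> 1; t > 0\<rbrakk> \<Longrightarrow> f r t = g r t" for f g :: "real \<Rightarrow> real \<Rightarrow> real"
    by (rule iffD2[OF continuous_on_cong that(1)]) (auto simp: heat_domain_def that(2))
  have "(\<lambda>x. u x t) differentiable (at r within {0..1})"
    "(\<lambda>x. partial_r u x t) differentiable (at r within {0..1})"
    "u r differentiable (at t)" if "0 \<le> r" "r \<le> 1" "t > 0" for r t
    using that A(1) dp A(3) unfolding real_differentiable_def by blast+
  then have "u \<in> C21"
    unfolding C21_def
    using A(4) cong[OF A(5) p] cong[OF A(6) q] cong[OF A(7) s]
    by auto
  moreover have "(u 0 has_real_derivative 1/2 * partial_r u 0 t) (at t)"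
    "(u 1 has_real_derivative - (1/2) * partial_r u 1 t) (at t)" if "t > 0" for t
    using A(3)[of 0 t] A(3)[of 1 t] A(9,10)[of t] p[of 0 t] p[of 1 t] that by simp_all
  ultimately show ?thesis
    unfolding is_bounded_solution_def Let_def
    using bdd init v0 v1 A(8) s q by auto
qed

lemma integral_le_0_imp_0:
  fixes f :: "real \<Rightarrow> real"
  assumes "continuous_on {a..b} f" "\<And>x. x \<in> {a..b} \<Longrightarrow> 0 \<le> f x" "integral {a..b} f \<le> 0"
    "a < b" "x \<in> {a..b}"
  shows "f x = 0"
proof -
  have i: "f integrable_on {a..b}"
    using assms(1) by (rule integrable_continuous_real)
  then have "integral {a..b} f = 0"
    using assms(2,3) by (intro antisym integral_nonneg) auto
  then have "(f has_integral 0) (cbox a b)"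
    using i by (metis integrable_integral interval_cbox)
  then show ?thesis
    using assms by (intro has_integral_0_cbox_imp_0[of a b f x]) auto
qed

text \<open>The energy argument differentiates the cubed positive part twice. The only delicate
  point is 0, where the difference quotient is bounded by a positive power of
  \<open>\<bar>h\<bar>\<close>.\<close>

lemma pos_cube_derivs:
  fixes x :: real
  shows "((\<lambda>x. max 0 x ^ 3) has_real_derivative 3 * max 0 x ^ 2) (at x)"
    and "((\<lambda>x. 3 * max 0 x ^ 2) has_real_derivative 6 * max 0 x) (at x)"
proof -
  \<comment> \<open>The exponent \<open>Suc (Suc n)\<close> covers the cube (\<open>n = 1\<close>)
    and the square (\<open>n = 0\<close>) at once.\<close>
  have *: "((\<lambda>x::real. max 0 x ^ Suc (Suc n)) has_real_derivative of_nat (Suc (Suc n)) * max 0 x ^ Suc n) (at x)"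
    for n
  proof (cases "x = 0")
    case True
    have "((\<lambda>h. max 0 h ^ Suc (Suc n) / h) \<longlongrightarrow> 0) (at (0::real))"
    proof (rule Lim_null_comparison)
      show "\<forall>\<^sub>F h in at 0. norm (max 0 h ^ Suc (Suc n) / h) \<le> \<bar>h\<bar> ^ Suc n"
        by (intro always_eventually allI) (auto simp: max_def abs_mult power_abs mult_nonpos_nonneg)
      show "((\<lambda>h::real. \<bar>h\<bar> ^ Suc n) \<longlongrightarrow> 0) (at 0)"
        by (auto intro!: tendsto_eq_intros)
    qed
    then show ?thesis
      using True by (simp add: has_field_derivative_iff)
  next
    case False
    show ?thesis
    proof (cases "x > 0")
      case True
      have "((\<lambda>x::real. x ^ Suc (Suc n)) has_real_derivative of_nat (Suc (Suc n)) * x ^ Suc n) (at x)"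
        by (rule derivative_eq_intros refl | simp)+
      then have "((\<lambda>x::real. max 0 x ^ Suc (Suc n)) has_real_derivative of_nat (Suc (Suc n)) * x ^ Suc n) (at x)"
        by (rule has_field_derivative_transform_within_open[where S="{0<..}"]) (use True in auto)
      then show ?thesis using True by simp
    next
      case F: False
      have "((\<lambda>x::real. 0) has_real_derivative 0) (at x)" by simp
      then have "((\<lambda>x::real. max 0 x ^ Suc (Suc n)) has_real_derivative 0) (at x)"
        by (rule has_field_derivative_transform_within_open[where S="{..<0}"]) (use False F in auto)
      then show ?thesis using False F by simp
    qed
  qed
  show "((\<lambda>x. max 0 x ^ 3) has_real_derivative 3 * max 0 x ^ 2) (at x)"
    using *[of 1] by (simp add: numeral_eq_Suc)
  have "((\<lambda>x. 3 * max 0 x ^ 2) has_real_derivative 3 * (2 * max 0 x)) (at x)"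
    using *[of 0] by (intro DERIV_cmult) (simp add: numeral_eq_Suc)
  then show "((\<lambda>x. 3 * max 0 x ^ 2) has_real_derivative 6 * max 0 x) (at x)"
    by simp
qed

text \<open>The bound on \<open>w\<close> is asked only for times up to 1, because dominated
  convergence is used only near time 0. This permits an application to \<open>heat\<close> before it
  is known to be bounded for all times.\<close>

lemma wentzell_comparison:
  assumes sol: "wentzell_solution w p q s"
    and bd: "\<And>r t. \<lbrakk>0 \<le> r; r \<le> 1; 0 < t; t \<le> 1\<rbrakk> \<Longrightarrow> \<bar>w r t\<bar> \<le> B"
    and lim: "\<And>r. 0 \<le> r \<Longrightarrow> r \<le> 1 \<Longrightarrow> \<exists>l\<le>0. (w r \<longlongrightarrow> l) (at_right 0)"
    and r: "0 \<le> r" "r \<le> 1" and "t > 0"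
  shows "w r t \<le> 0"
proof -
  note A = wentzell_solutionD[OF sol]
  define f where "f = (\<lambda>x::real. max 0 x ^ 3)"
  define f1 where "f1 = (\<lambda>x::real. 3 * max 0 x ^ 2)"
  define f2 where "f2 = (\<lambda>x::real. 6 * max 0 x)"
  have df: "(f has_real_derivative f1 x) (at x within S)" "(f1 has_real_derivative f2 x) (at x within S)" for x S
    using pos_cube_derivs[of x] unfolding f_def f1_def f2_def
    by (auto intro: has_field_derivative_at_within)
  have cf: "continuous_on S f" "continuous_on S f1" "continuous_on S f2" for S
    unfolding f_def f1_def f2_def by (auto intro!: continuous_intros)
  have f_nonneg: "f x \<ge> 0" "f2 x \<ge> 0" for x by (auto simp: f_def f2_def)
  define E where "E t = integral {0..1} (\<lambda>r. f (w r t)) + f (w 0 t) + f (w 1 t)" for t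
  have slice: "continuous_on {0..1} (\<lambda>r. g r t)"
    if "continuous_on heat_domain (\<lambda>(r, t). g r t)" "t > 0" for g :: "real \<Rightarrow> real \<Rightarrow> real" and t
    by (rule continuous_on_compose2[OF that(1), where f="\<lambda>r. (r, t)", simplified])
       (use \<open>t > 0\<close> in \<open>auto simp: heat_domain_def intro!: continuous_intros\<close>)
  have cw: "continuous_on {0..1} (\<lambda>r. f (w r t))" if "t > 0" for t
    by (rule continuous_on_compose2[OF cf(1)[of UNIV] slice[OF A(4) that]]) auto
  have DE: "\<exists>d\<le>0. (E has_real_derivative d) (at t)" if t: "t > 0" for t
  proof -
    \<comment> \<open>The rule for differentiating under the integral expects the parameter
      \<open>t\<close> in the first component.\<close>
    have swap: "continuous_on ({0<..} \<times> {0..1}) (\<lambda>(t, r). g r t)"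
      if "continuous_on heat_domain (\<lambda>(r, t). g r t)" for g :: "real \<Rightarrow> real \<Rightarrow> real"
      using continuous_on_compose2[OF that, of "{0<..} \<times> {0..1}" prod.swap]
      by (force simp: heat_domain_def case_prod_unfold intro!: continuous_intros)
    have "((\<lambda>t. integral (cbox 0 1) (\<lambda>r. f (w r t))) has_real_derivative
        integral (cbox 0 1) (\<lambda>r. f1 (w r t) * s r t)) (at t within {0<..})"
    proof (rule leibniz_rule_field_derivative)
      show "((\<lambda>t. f (w r t)) has_real_derivative f1 (w r t) * s r t) (at t within {0<..})"
        if "t \<in> {0<..}" "r \<in> cbox 0 1" for t r
        using that by (intro DERIV_chain2[OF df(1) has_field_derivative_at_within[OF A(3)]]) auto
      show "(\<lambda>r. f (w r t)) integrable_on cbox 0 1" if "t \<in> {0<..}" for t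
        using cw[of t] that unfolding cbox_interval by (auto intro: integrable_continuous_real)
      have "continuous_on ({0<..} \<times> {0..1}) (\<lambda>x. f1 ((case x of (t, r) \<Rightarrow> w r t)))"
        by (rule continuous_on_compose2[OF cf(2)[of UNIV] swap[OF A(4)]]) auto
      from continuous_on_mult[OF this swap[OF A(7)]]
      show "continuous_on ({0<..} \<times> cbox 0 1) (\<lambda>(t, r). f1 (w r t) * s r t)"
        by (simp add: case_prod_unfold)
    qed (use t in auto)
    then have 1: "((\<lambda>t. integral {0..1} (\<lambda>r. f (w r t))) has_real_derivative
        integral {0..1} (\<lambda>r. f1 (w r t) * s r t)) (at t)"
      using t by (simp add: at_within_open[OF _ open_greaterThan])
    have 2: "((\<lambda>t. f (w 0 t)) has_real_derivative f1 (w 0 t) * (1/2 * p 0 t)) (at t)"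
      using t A(3)[of 0 t] A(9)[of t] by (intro DERIV_chain2[OF df(1)]) auto
    have 3: "((\<lambda>t. f (w 1 t)) has_real_derivative f1 (w 1 t) * (- (1/2) * p 1 t)) (at t)"
      using t A(3)[of 1 t] A(10)[of t] by (intro DERIV_chain2[OF df(1)]) auto
    \<comment> \<open>Integration by parts: the integrand is the derivative in \<open>r\<close> of
      \<open>f1 (w r t) * p r t\<close>.\<close>
    have "((\<lambda>r. f2 (w r t) * p r t * p r t + q r t * f1 (w r t)) has_integral
        f1 (w 1 t) * p 1 t - f1 (w 0 t) * p 0 t) {0..1}"
      unfolding has_real_derivative_iff_has_vector_derivative[symmetric]
      by (rule fundamental_theorem_of_calculus)
         (use t A(1,2) in \<open>auto simp: has_real_derivative_iff_has_vector_derivative[symmetric]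
           intro!: DERIV_mult DERIV_chain2[OF df(2)]\<close>)
    moreover have i1: "(\<lambda>r. f2 (w r t) * (p r t)\<^sup>2) integrable_on {0..1}"
      using slice[OF A(4) t] slice[OF A(5) t]
      by (intro integrable_continuous_real continuous_intros continuous_on_compose2[OF cf(3)[of UNIV]]) auto
    ultimately have "((\<lambda>r. q r t * f1 (w r t)) has_integral
        f1 (w 1 t) * p 1 t - f1 (w 0 t) * p 0 t - integral {0..1} (\<lambda>r. f2 (w r t) * (p r t)\<^sup>2)) {0..1}"
      using has_integral_diff[OF _ integrable_integral[OF i1]] by (fastforce simp: power2_eq_square algebra_simps)
    then have "((\<lambda>r. 1/2 * (q r t * f1 (w r t))) has_integral
        1/2 * (f1 (w 1 t) * p 1 t - f1 (w 0 t) * p 0 t - integral {0..1} (\<lambda>r. f2 (w r t) * (p r t)\<^sup>2))) {0..1}"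
      by (rule has_integral_mult_right)
    \<comment> \<open>The equation \<open>s = q / 2\<close> holds in the open interval, so the
      integrand is altered at the two endpoints.\<close>
    then have "((\<lambda>r. f1 (w r t) * s r t) has_integral
        1/2 * (f1 (w 1 t) * p 1 t - f1 (w 0 t) * p 0 t - integral {0..1} (\<lambda>r. f2 (w r t) * (p r t)\<^sup>2))) {0..1}"
      by (rule has_integral_spike_finite[where S="{0,1}", rotated 2]) (use A(8) t in auto)
    then have I: "integral {0..1} (\<lambda>r. f1 (w r t) * s r t) =
        1/2 * (f1 (w 1 t) * p 1 t - f1 (w 0 t) * p 0 t - integral {0..1} (\<lambda>r. f2 (w r t) * (p r t)\<^sup>2))"
      by (rule integral_unique)
    have "integral {0..1} (\<lambda>r. f2 (w r t) * (p r t)\<^sup>2) \<ge> 0"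
      using f_nonneg by (intro integral_nonneg i1) auto
    \<comment> \<open>The endpoint terms of the integration by parts cancel those supplied by the
      dynamic boundary conditions, leaving minus half of a nonnegative integral.\<close>
    then have "integral {0..1} (\<lambda>r. f1 (w r t) * s r t) + f1 (w 0 t) * (1/2 * p 0 t) + f1 (w 1 t) * (- (1/2) * p 1 t) \<le> 0"
      unfolding I by (simp add: algebra_simps)
    moreover have "(E has_real_derivative integral {0..1} (\<lambda>r. f1 (w r t) * s r t) + f1 (w 0 t) * (1/2 * p 0 t) + f1 (w 1 t) * (- (1/2) * p 1 t)) (at t)"
      unfolding E_def by (intro DERIV_add 1 2 3)
    ultimately show ?thesis by blast
  qed
  \<comment> \<open>Times in (0,1], where the bound \<open>B\<close> applies, that decrease to
    0.\<close>
  define tn where "tn = (\<lambda>n. 1 / real (Suc n))"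
  have tn: "0 < tn n" "tn n \<le> 1" for n by (auto simp: tn_def)
  have tn0: "filterlim tn (at_right 0) sequentially"
    unfolding tn_def using LIMSEQ_Suc[OF lim_1_over_n]
    by (intro tendsto_imp_filterlim_at_right) auto
  have limf: "(\<lambda>n. f (w r (tn n))) \<longlonglongrightarrow> 0" if "0 \<le> r" "r \<le> 1" for r
  proof -
    obtain l where l: "l \<le> 0" "(w r \<longlongrightarrow> l) (at_right 0)" using lim \<open>0 \<le> r\<close> \<open>r \<le> 1\<close> by blast
    have "(\<lambda>n. f (w r (tn n))) \<longlonglongrightarrow> f l"
      using filterlim_compose[OF l(2) tn0] cf(1)[of UNIV]
      by (intro continuous_on_tendsto_compose[where f=f and s=UNIV]) auto
    then show ?thesis using l(1) by (simp add: f_def)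
  qed
  have "(\<lambda>n. integral {0..1} (\<lambda>r. f (w r (tn n)))) \<longlonglongrightarrow> integral {0..1} (\<lambda>r::real. 0::real)"
  proof (rule dominated_convergence)
    show "(\<lambda>r. f (w r (tn n))) integrable_on {0..1}" for n
      using cw[OF tn(1)] by (rule integrable_continuous_real)
    show "norm (f (w r (tn n))) \<le> \<bar>B\<bar> ^ 3" if "r \<in> {0..1}" for n r
      using bd[of r "tn n"] tn[of n] that by (auto simp: f_def intro!: power_mono)
  qed (use limf in auto)
  then have "(\<lambda>n. E (tn n)) \<longlonglongrightarrow> 0 + 0 + 0"
    unfolding E_def by (intro tendsto_add limf) auto
  moreover have "\<forall>\<^sub>F n in sequentially. E t \<le> E (tn n)"
  proof -
    have "\<forall>\<^sub>F n in sequentially. tn n < t"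
      using LIMSEQ_Suc[OF lim_1_over_n] \<open>t > 0\<close> unfolding tn_def by (intro order_tendstoD) auto
    then show ?thesis
    proof eventually_elim
      case (elim n)
      show ?case
        by (rule DERIV_nonpos_imp_nonincreasing) (use elim DE tn(1)[of n] in \<open>auto intro: less_le_trans\<close>)
    qed
  qed
  ultimately have "E t \<le> 0"
    using tendsto_lowerbound[of "\<lambda>n. E (tn n)" 0] by simp
  moreover have pos: "integral {0..1} (\<lambda>r. f (w r t)) \<ge> 0"
    using f_nonneg cw[OF \<open>t > 0\<close>] by (intro integral_nonneg integrable_continuous_real) auto
  ultimately have "integral {0..1} (\<lambda>r. f (w r t)) \<le> 0"
    unfolding E_def using f_nonneg(1)[of "w 0 t"] f_nonneg(1)[of "w 1 t"] by linarith
  \<comment> \<open>By continuity a vanishing integral forces the nonnegative integrand to vanish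
    everywhere, endpoints included.\<close>
  with integral_le_0_imp_0[OF cw[OF \<open>t > 0\<close>]] f_nonneg(1) r have "f (w r t) = 0"
    by simp
  then show ?thesis by (simp add: f_def split: if_splits)
qed

subsection \<open>Gaussian convolution of exponentially bounded data\<close>

lemma integral_dominated_convergence_within:
  fixes f :: "'b::metric_space \<Rightarrow> 'a \<Rightarrow> real"
  assumes "g \<in> borel_measurable M" "\<And>x. x \<in> S \<Longrightarrow> f x \<in> borel_measurable M" "integrable M h"
    and lim: "AE y in M. ((\<lambda>x. f x y) \<longlongrightarrow> g y) (at a within S)"
    and bound: "\<And>x y. x \<in> S \<Longrightarrow> x \<noteq> a \<Longrightarrow> y \<in> space M \<Longrightarrow> \<bar>f x y\<bar> \<le> h y"
  shows "((\<lambda>x. \<integral>y. f x y \<partial>M) \<longlongrightarrow> (\<integral>y. g y \<partial>M)) (at a within S)"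
  unfolding tendsto_at_iff_sequentially comp_def
proof (intro allI impI)
  fix X :: "nat \<Rightarrow> 'b"
  assume X: "\<forall>i. X i \<in> S - {a}" "X \<longlonglongrightarrow> a"
  show "(\<lambda>n. \<integral>y. f (X n) y \<partial>M) \<longlonglongrightarrow> (\<integral>y. g y \<partial>M)"
  proof (rule integral_dominated_convergence[where w=h])
    show "AE y in M. (\<lambda>n. f (X n) y) \<longlonglongrightarrow> g y"
      using lim by eventually_elim (use X in \<open>auto simp: tendsto_at_iff_sequentially comp_def\<close>)
  qed (use assms X in auto)
qed

text \<open>The mean value inequality on the convex set \<open>S\<close> bounds every difference
  quotient by \<open>h\<close>, so dominated convergence applies to the quotients.\<close>

lemma has_real_derivative_lebesgue_integral:
  fixes f f' :: "real \<Rightarrow> 'a \<Rightarrow> real"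
  assumes S: "open S" "convex S" "x \<in> S"
    and deriv: "\<And>x y. x \<in> S \<Longrightarrow> y \<in> space M \<Longrightarrow> ((\<lambda>x. f x y) has_real_derivative f' x y) (at x)"
    and int: "\<And>x. x \<in> S \<Longrightarrow> integrable M (f x)"
    and meas: "f' x \<in> borel_measurable M"
    and bound: "\<And>x y. x \<in> S \<Longrightarrow> y \<in> space M \<Longrightarrow> \<bar>f' x y\<bar> \<le> h y" and h: "integrable M h"
  shows "((\<lambda>x. \<integral>y. f x y \<partial>M) has_real_derivative (\<integral>y. f' x y \<partial>M)) (at x)"
proof -
  have "((\<lambda>z. \<integral>y. (f z y - f x y) / (z - x) \<partial>M) \<longlongrightarrow> (\<integral>y. f' x y \<partial>M)) (at x within S)"
  proof (rule integral_dominated_convergence_within[where h=h, OF meas _ h])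
    show "(\<lambda>y. (f z y - f x y) / (z - x)) \<in> borel_measurable M" if "z \<in> S" for z
      using int[OF that] int[OF S(3)] by (intro borel_measurable_divide borel_measurable_diff) auto
    show "AE y in M. ((\<lambda>z. (f z y - f x y) / (z - x)) \<longlongrightarrow> f' x y) (at x within S)"
      using has_field_derivative_at_within[OF deriv[OF S(3)]]
      by (intro AE_I2) (simp add: has_field_derivative_iff)
    show "\<bar>(f z y - f x y) / (z - x)\<bar> \<le> h y" if "z \<in> S" "z \<noteq> x" "y \<in> space M" for z y
    proof -
      have "norm (f z y - f x y) \<le> h y * norm (z - x)"
      proof (rule field_differentiable_bound[OF S(2) _ _ that(1) S(3)])
        show "((\<lambda>x. f x y) has_real_derivative f' x y) (at x within S)" if "x \<in> S" for x
          using deriv[OF that \<open>y \<in> space M\<close>] by (rule has_field_derivative_at_within)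
        show "norm (f' x y) \<le> h y" if "x \<in> S" for x
          using bound[OF that \<open>y \<in> space M\<close>] by simp
      qed
      then show ?thesis using that by (simp add: field_simps)
    qed
  qed
  then have "((\<lambda>z. \<integral>y. (f z y - f x y) / (z - x) \<partial>M) \<longlongrightarrow> (\<integral>y. f' x y \<partial>M)) (at x)"
    by (simp only: at_within_open[OF S(3,1)])
  moreover have "\<forall>\<^sub>F z in at x. (\<integral>y. (f z y - f x y) / (z - x) \<partial>M)
      = ((\<integral>y. f z y \<partial>M) - (\<integral>y. f x y \<partial>M)) / (z - x)"
    using eventually_at_in_open'[OF S(1,3)]
    by eventually_elim (use int S(3) in simp)
  ultimately show ?thesis
    unfolding has_field_derivative_iff by (rule Lim_transform_eventually)
qed

lemma integrable_exp_minus_abs: "integrable lborel (\<lambda>x::real. exp (- \<bar>x\<bar>))"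
proof -
  have "integrable lborel (\<lambda>x. exponential_density 1 x)"
  proof (rule integrableI_nonneg)
    have "(\<integral>\<^sup>+ x. ennreal (exponential_density 1 x) \<partial>lborel) = 1"
      using prob_space.emeasure_space_1[OF prob_space_exponential_density[of 1]]
      by (simp add: emeasure_density)
    then show "(\<integral>\<^sup>+ x. ennreal (exponential_density 1 x) \<partial>lborel) < \<infinity>" by simp
  qed (auto simp: exponential_density_nonneg)
  then have 1: "integrable lborel (\<lambda>x. exponential_density 1 x)" .
  have 2: "integrable lborel (\<lambda>x. exponential_density 1 (0 + (-1) * x))"
    using 1 by (subst lborel_integrable_real_affine_iff) auto
  \<comment> \<open>The exponential density of rate 1 and its mirror image add up to
    \<open>exp (- \<bar>x\<bar>)\<close> off 0 and to 2 at 0.\<close>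
  show ?thesis
    by (rule Bochner_Integration.integrable_bound[OF Bochner_Integration.integrable_add[OF 1 2]])
       (auto simp: exponential_density_def)
qed

section \<open>Gaussian moments and their derivatives\<close>

locale exp_bounded =
  fixes F :: "real \<Rightarrow> real" and A a :: real
  assumes F_measurable [measurable]: "F \<in> borel_measurable borel"
    and F_le: "\<And>y. \<bar>F y\<bar> \<le> A * exp (a * \<bar>y\<bar>)"
    and a_nonneg: "a \<ge> 0"
begin

lemma A_nonneg: "A \<ge> 0"
  using F_le[of 0] by simp

text \<open>The power is absorbed into \<open>exp (k * \<bar>r - y\<bar>)\<close>, and one extra
  unit of growth rate, \<open>a + 1\<close> instead of \<open>a\<close>, is spent to leave the
  integrable factor \<open>exp (- \<bar>y\<bar>)\<close>. Uniformity in \<open>r\<close> and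
  \<open>t\<close> makes this the dominating function for the limits below.\<close>

lemma gauss_bound:
  assumes "\<bar>r\<bar> \<le> R" "0 < t" "t \<le> T"
  shows "\<bar>(r - y)^k * exp (- (r - y)\<^sup>2 / (2*t)) * F y\<bar>
    \<le> A * exp ((a + 1) * R + T * (a + 1 + k)\<^sup>2 / 2) * exp (- \<bar>y\<bar>)"
proof -
  define x where "x = \<bar>r - y\<bar>"
  have x: "x \<ge> 0" "\<bar>y\<bar> \<le> x + R" "(r - y)\<^sup>2 = x\<^sup>2" using assms(1) by (auto simp: x_def)
  have "x ^ k \<le> exp x ^ k"
    using x(1) exp_ge_add_one_self[of x] by (intro power_mono) linarith+
  then have xk: "x ^ k \<le> exp (k * x)" by (simp add: exp_of_nat_mult)
  have "x\<^sup>2 / (2*T) \<le> x\<^sup>2 / (2*t)"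
    using assms by (intro divide_left_mono) auto
  \<comment> \<open>Completing the square: the maximum is attained at
    \<open>x = T * (a + 1 + k)\<close>.\<close>
  moreover have "(a + 1 + k) * x - x\<^sup>2 / (2*T) \<le> T * (a + 1 + k)\<^sup>2 / 2"
  proof -
    have "0 \<le> (x - T * (a + 1 + k))\<^sup>2 / (2*T)" using assms by simp
    also have "\<dots> = x\<^sup>2 / (2*T) - (a + 1 + k) * x + T * (a + 1 + k)\<^sup>2 / 2"
      using assms by (simp add: field_simps power2_eq_square)
    finally show ?thesis by simp
  qed
  moreover have "(a + 1) * \<bar>y\<bar> \<le> (a + 1) * (x + R)"
    using x a_nonneg by (intro mult_left_mono) auto
  ultimately have e: "k * x - x\<^sup>2 / (2*t) + a * \<bar>y\<bar> \<le> (a + 1) * R + T * (a + 1 + k)\<^sup>2 / 2 - \<bar>y\<bar>"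
    by (simp add: algebra_simps)
  have "\<bar>(r - y)^k * exp (- (r - y)\<^sup>2 / (2*t)) * F y\<bar> = x ^ k * exp (- x\<^sup>2 / (2*t)) * \<bar>F y\<bar>"
    by (simp add: abs_mult power_abs x_def)
  also have "\<dots> \<le> exp (k * x) * exp (- x\<^sup>2 / (2*t)) * (A * exp (a * \<bar>y\<bar>))"
    using xk F_le x by (intro mult_mono) auto
  also have "\<dots> = A * exp (k * x - x\<^sup>2 / (2*t) + a * \<bar>y\<bar>)"
    by (simp add: exp_add[symmetric] exp_diff field_simps)
  also have "\<dots> \<le> A * exp ((a + 1) * R + T * (a + 1 + k)\<^sup>2 / 2 - \<bar>y\<bar>)"
    using e A_nonneg by (intro mult_left_mono) auto
  finally show ?thesis by (simp only: exp_diff exp_minus divide_inverse mult.assoc)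
qed

text \<open>Unnormalised Gaussian moments. Differentiation in \<open>r\<close> or \<open>t\<close>
  yields combinations of the same family with coefficients depending on \<open>t\<close> and
  \<open>k\<close>.\<close>

definition moment :: "nat \<Rightarrow> real \<Rightarrow> real \<Rightarrow> real" where
  "moment k r t = (\<integral>y. (r - y)^k * exp (- (r - y)\<^sup>2 / (2*t)) * F y \<partial>lborel)"

lemma gauss_integrable:
  assumes "t > 0"
  shows "integrable lborel (\<lambda>y. (r - y)^k * exp (- (r - y)\<^sup>2 / (2*t)) * F y)"
proof (rule Bochner_Integration.integrable_bound)
  show "integrable lborel (\<lambda>y. A * exp ((a + 1) * \<bar>r\<bar> + t * (a + 1 + k)\<^sup>2 / 2) * exp (- \<bar>y\<bar>))"
    using integrable_exp_minus_abs by simp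
  show "AE y in lborel. norm ((r - y)^k * exp (- (r - y)\<^sup>2 / (2*t)) * F y)
      \<le> norm (A * exp ((a + 1) * \<bar>r\<bar> + t * (a + 1 + k)\<^sup>2 / 2) * exp (- \<bar>y\<bar>))"
    using gauss_bound[OF order_refl assms order_refl] A_nonneg by (auto simp: abs_mult)
qed auto

lemma continuous_on_moment: "continuous_on (UNIV \<times> {0<..}) (\<lambda>(r, t). moment k r t)"
proof -
  have "isCont (\<lambda>(r, t). moment k r t) (r, t)" if "t > 0" for r t
  proof -
    \<comment> \<open>A box with positive times on which \<open>gauss_bound\<close> provides one
      dominating function.\<close>
    define S where "S = {r - 1<..<r + 1} \<times> {t / 2<..<t + 1}"
    have S: "open S" "(r, t) \<in> S" using that by (auto simp: S_def intro: open_Times)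
    have "((\<lambda>z. \<integral>y. (fst z - y)^k * exp (- (fst z - y)\<^sup>2 / (2 * snd z)) * F y \<partial>lborel) \<longlongrightarrow>
        (\<integral>y. (r - y)^k * exp (- (r - y)\<^sup>2 / (2*t)) * F y \<partial>lborel)) (at (r, t) within S)"
    proof (rule integral_dominated_convergence_within[where h="\<lambda>y. A * exp ((a + 1) * (\<bar>r\<bar> + 1) + (t + 1) * (a + 1 + k)\<^sup>2 / 2) * exp (- \<bar>y\<bar>)"])
      show "\<bar>(fst z - y)^k * exp (- (fst z - y)\<^sup>2 / (2 * snd z)) * F y\<bar>
         \<le> A * exp ((a + 1) * (\<bar>r\<bar> + 1) + (t + 1) * (a + 1 + k)\<^sup>2 / 2) * exp (- \<bar>y\<bar>)"
        if "z \<in> S" for z y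
        using that \<open>t > 0\<close> by (intro gauss_bound) (auto simp: S_def)
      have "((\<lambda>z. (fst z - y)^k * exp (- (fst z - y)\<^sup>2 / (2 * snd z)) * F y) \<longlongrightarrow>
          (r - y)^k * exp (- (r - y)\<^sup>2 / (2*t)) * F y) (at (r, t) within S)" for y
      proof -
        have "isCont (\<lambda>z. (fst z - y)^k * exp (- (fst z - y)\<^sup>2 / (2 * snd z)) * F y) (r, t)"
          using that by (intro continuous_intros) simp_all
        then show ?thesis
          using tendsto_within_subset[OF _ subset_UNIV] by (fastforce simp: isCont_def)
      qed
      then show "AE y in lborel. ((\<lambda>z. (fst z - y)^k * exp (- (fst z - y)\<^sup>2 / (2 * snd z)) * F y) \<longlongrightarrow>
          (r - y)^k * exp (- (r - y)\<^sup>2 / (2*t)) * F y) (at (r, t) within S)"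
        by simp
    qed (use integrable_exp_minus_abs in auto)
    then show ?thesis
      unfolding at_within_open[OF S(2,1)] by (simp add: isCont_def moment_def case_prod_unfold)
  qed
  then show ?thesis
    by (intro continuous_at_imp_continuous_on) auto
qed

text \<open>The two terms come from the power and from the exponential. For \<open>k = 0\<close> the
  truncated index \<open>k - 1\<close> is harmless, because its coefficient is
  \<open>k\<close>.\<close>

lemma DERIV_moment_r:
  assumes t: "t > 0"
  shows "((\<lambda>r. moment k r t) has_real_derivative
     (k * moment (k - 1) r t - moment (Suc k) r t / t)) (at r)"
proof -
  define f' where "f' r y = k * ((r - y)^(k - 1) * exp (- (r - y)\<^sup>2 / (2*t)) * F y)
     - ((r - y)^Suc k * exp (- (r - y)\<^sup>2 / (2*t)) * F y) / t" for r y
  define C where "C = (\<lambda>k::nat. A * exp ((a + 1) * (\<bar>r\<bar> + 1) + t * (a + 1 + k)\<^sup>2 / 2))"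
  have "((\<lambda>r. moment k r t) has_real_derivative (\<integral>y. f' r y \<partial>lborel)) (at r)"
    unfolding moment_def
  proof (rule has_real_derivative_lebesgue_integral[where S="{r - 1<..<r + 1}"
        and h="\<lambda>y. k * (C (k - 1) * exp (- \<bar>y\<bar>)) + (C (Suc k) * exp (- \<bar>y\<bar>)) / t"])
    show "((\<lambda>r. (r - y)^k * exp (- (r - y)\<^sup>2 / (2*t)) * F y) has_real_derivative f' x y) (at x)" for x y
      unfolding f'_def using t by (auto intro!: derivative_eq_intros simp: field_simps power2_eq_square)
    show "\<bar>f' x y\<bar> \<le> k * (C (k - 1) * exp (- \<bar>y\<bar>)) + (C (Suc k) * exp (- \<bar>y\<bar>)) / t"
      if "x \<in> {r - 1<..<r + 1}" for x y
    proof -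
      have B: "\<bar>(x - y)^j * exp (- (x - y)\<^sup>2 / (2*t)) * F y\<bar> \<le> C j * exp (- \<bar>y\<bar>)" for j
        unfolding C_def using that t by (intro gauss_bound) auto
      have "\<bar>f' x y\<bar> \<le> \<bar>k * ((x - y)^(k - 1) * exp (- (x - y)\<^sup>2 / (2*t)) * F y)\<bar>
          + \<bar>((x - y)^Suc k * exp (- (x - y)\<^sup>2 / (2*t)) * F y) / t\<bar>"
        unfolding f'_def by (rule abs_triangle_ineq4)
      also have "\<dots> \<le> k * (C (k - 1) * exp (- \<bar>y\<bar>)) + (C (Suc k) * exp (- \<bar>y\<bar>)) / t"
        using add_mono[OF mult_left_mono[OF B[of "k - 1"] of_nat_0_le_iff[of k]]
            divide_right_mono[OF B[of "Suc k"] less_imp_le[OF t]]] t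
        by (simp only: abs_mult abs_divide abs_of_nat abs_of_pos)
      finally show ?thesis .
    qed
  qed (use gauss_integrable[OF t] integrable_exp_minus_abs in \<open>auto simp: f'_def\<close>)
  also have "(\<integral>y. f' r y \<partial>lborel) = k * moment (k - 1) r t - moment (Suc k) r t / t"
    unfolding f'_def moment_def using gauss_integrable[OF t] by (simp del: power_Suc)
  finally show ?thesis .
qed

lemma DERIV_moment_t:
  assumes t: "t > 0"
  shows "((\<lambda>t. moment k r t) has_real_derivative moment (k + 2) r t / (2 * t\<^sup>2)) (at t)"
proof -
  define f' where "f' t y = ((r - y)^(k + 2) * exp (- (r - y)\<^sup>2 / (2*t)) * F y) / (2 * t\<^sup>2)" for t y
  define C where "C = A * exp ((a + 1) * \<bar>r\<bar> + (t + 1) * (a + 1 + (k + 2 :: nat))\<^sup>2 / 2)"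
  have "((\<lambda>t. moment k r t) has_real_derivative (\<integral>y. f' t y \<partial>lborel)) (at t)"
    unfolding moment_def
  \<comment> \<open>The lower end \<open>t / 2\<close> controls the factor
    \<open>1 / (2 * x\<^sup>2)\<close> produced by the time derivative; the upper end
    \<open>t + 1\<close> enters \<open>C\<close>.\<close>
  proof (rule has_real_derivative_lebesgue_integral[where S="{t / 2<..<t + 1}"
        and h="\<lambda>y. (C * exp (- \<bar>y\<bar>)) / (2 * (t / 2)\<^sup>2)"])
    show "((\<lambda>t. (r - y)^k * exp (- (r - y)\<^sup>2 / (2*t)) * F y) has_real_derivative f' x y) (at x)"
      if "x \<in> {t / 2<..<t + 1}" for x y
    proof -
      have "x > 0" using that t by auto
      then show ?thesis
        unfolding f'_def
        by (auto intro!: derivative_eq_intros simp: field_simps power2_eq_square)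
    qed
    show "\<bar>f' x y\<bar> \<le> (C * exp (- \<bar>y\<bar>)) / (2 * (t / 2)\<^sup>2)"
      if "x \<in> {t / 2<..<t + 1}" for x y
    proof -
      have "x > 0" using that t by auto
      have "\<bar>(r - y)^(k + 2) * exp (- (r - y)\<^sup>2 / (2*x)) * F y\<bar> \<le> C * exp (- \<bar>y\<bar>)"
        unfolding C_def using that \<open>x > 0\<close> by (intro gauss_bound) auto
      moreover have "(t / 2)\<^sup>2 \<le> x\<^sup>2" using that t by (intro power_mono) auto
      ultimately show ?thesis
        unfolding f'_def abs_divide using t by (intro frac_le) auto
    qed
  qed (use gauss_integrable t integrable_exp_minus_abs in \<open>auto simp: f'_def\<close>)
  also have "(\<integral>y. f' t y \<partial>lborel) = moment (k + 2) r t / (2 * t\<^sup>2)"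
    unfolding f'_def moment_def by simp
  finally show ?thesis .
qed

text \<open>Convolution with the Gaussian density of variance \<open>t\<close>, the kernel of the
  heat equation with factor 1/2.\<close>

definition heat :: "real \<Rightarrow> real \<Rightarrow> real" where
  "heat r t = moment 0 r t / sqrt (2 * pi * t)"

definition heat_r :: "real \<Rightarrow> real \<Rightarrow> real" where
  "heat_r r t = - moment 1 r t / (t * sqrt (2 * pi * t))"

definition heat_rr :: "real \<Rightarrow> real \<Rightarrow> real" where
  "heat_rr r t = (moment 2 r t / t\<^sup>2 - moment 0 r t / t) / sqrt (2 * pi * t)"

lemma DERIV_heat:
  assumes t: "t > 0"
  shows "((\<lambda>r. heat r t) has_real_derivative heat_r r t) (at r)"
    and "((\<lambda>r. heat_r r t) has_real_derivative heat_rr r t) (at r)"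
    and "(heat r has_real_derivative 1/2 * heat_rr r t) (at t)"
proof -
  have [simp]: "2 * pi * t > 0" "sqrt (2 * pi * t) \<noteq> 0" using t by auto
  show "((\<lambda>r. heat r t) has_real_derivative heat_r r t) (at r)"
    using DERIV_cdivide[OF DERIV_moment_r[OF t, of 0], of "sqrt (2 * pi * t)" r]
    unfolding heat_def heat_r_def by simp
  show "((\<lambda>r. heat_r r t) has_real_derivative heat_rr r t) (at r)"
    unfolding heat_r_def minus_divide_left[symmetric] minus_divide_right
    by (rule DERIV_cong[OF DERIV_cdivide[OF DERIV_moment_r[OF t]]])
       (use t in \<open>simp add: heat_rr_def field_simps numeral_2_eq_2\<close>)
  define c where "c = sqrt (2 * pi * t)"
  have c: "c \<noteq> 0" "c * c = 2 * pi * t" using t by (auto simp: c_def)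
  have "((\<lambda>t. 2 * pi * t) has_real_derivative 2 * pi) (at t)"
    by (auto intro!: derivative_eq_intros)
  from DERIV_chain2[OF DERIV_real_sqrt this]
  have "((\<lambda>t. sqrt (2 * pi * t)) has_real_derivative inverse c / 2 * (2 * pi)) (at t)"
    using t by (simp add: c_def)
  also have "inverse c / 2 * (2 * pi) = c / (2 * t)"
    using c t by (simp add: field_simps)
  finally have "((\<lambda>t. sqrt (2 * pi * t)) has_real_derivative c / (2 * t)) (at t)" .
  from DERIV_divide[OF DERIV_moment_t[OF t, of 0 r] this]
  have "((\<lambda>t. moment 0 r t / sqrt (2 * pi * t)) has_real_derivative
      (moment 2 r t / (2 * t\<^sup>2) * c - moment 0 r t * (c / (2 * t))) / (c * c)) (at t)"
    using c(1) by (simp add: c_def[symmetric] numeral_2_eq_2)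
  also have "(moment 2 r t / (2 * t\<^sup>2) * c - moment 0 r t * (c / (2 * t))) / (c * c) = 1/2 * heat_rr r t"
    unfolding heat_rr_def c_def[symmetric] using c(1) t by (simp add: field_simps power2_eq_square)
  finally have "((\<lambda>t. moment 0 r t / sqrt (2 * pi * t)) has_real_derivative 1/2 * heat_rr r t) (at t)" .
  then show "(heat r has_real_derivative 1/2 * heat_rr r t) (at t)"
    by (simp add: heat_def[abs_def])
qed

lemma continuous_on_heat:
  "continuous_on (UNIV \<times> {0<..}) (\<lambda>(r, t). heat r t)"
  "continuous_on (UNIV \<times> {0<..}) (\<lambda>(r, t). heat_r r t)"
  "continuous_on (UNIV \<times> {0<..}) (\<lambda>(r, t). heat_rr r t)"
  using continuous_on_moment
  unfolding heat_def heat_r_def heat_rr_def case_prod_unfold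
  by (auto intro!: continuous_intros)

end

section \<open>The symmetry exchanging the endpoints 0 and 1\<close>

lemma (in exp_bounded) exp_bounded_reflect: "exp_bounded (\<lambda>y. F (1 - y)) (A * exp a) a"
proof
  show "\<bar>F (1 - y)\<bar> \<le> A * exp a * exp (a * \<bar>y\<bar>)" for y
  proof -
    have "\<bar>F (1 - y)\<bar> \<le> A * exp (a * \<bar>1 - y\<bar>)" by (rule F_le)
    also have "\<dots> \<le> A * exp (a * (1 + \<bar>y\<bar>))"
      using a_nonneg A_nonneg by (intro mult_left_mono iffD2[OF exp_le_cancel_iff]) auto
    finally show ?thesis by (simp add: distrib_left exp_add mult.assoc)
  qed
qed (use a_nonneg in auto)

lemma (in exp_bounded) moment_reflect:
  "exp_bounded.moment (\<lambda>y. F (1 - y)) k r t = (-1)^k * moment k (1 - r) t"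
proof -
  interpret R: exp_bounded "\<lambda>y. F (1 - y)" "A * exp a" a by (rule exp_bounded_reflect)
  have "moment k (1 - r) t = (\<integral>y. (1 - r - (1 - y))^k * exp (- (1 - r - (1 - y))\<^sup>2 / (2*t)) * F (1 - y) \<partial>lborel)"
    unfolding moment_def by (subst lborel_integral_real_affine[of "-1" _ 1]) auto
  also have "\<dots> = (\<integral>y. (-1)^k * ((r - y)^k * exp (- (r - y)\<^sup>2 / (2*t)) * F (1 - y)) \<partial>lborel)"
  proof (rule Bochner_Integration.integral_cong[OF refl])
    fix y :: real
    have "1 - r - (1 - y) = - (r - y)" by simp
    then show "(1 - r - (1 - y))^k * exp (- (1 - r - (1 - y))\<^sup>2 / (2*t)) * F (1 - y)
      = (-1)^k * ((r - y)^k * exp (- (r - y)\<^sup>2 / (2*t)) * F (1 - y))"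
      by (simp only: power_minus[of "r - y" k] power2_minus mult.assoc)
  qed
  also have "\<dots> = (-1)^k * R.moment k r t" by (simp add: R.moment_def)
  finally show ?thesis by simp
qed

text \<open>The sign in the first derivative turns \<open>heat_rr = heat_r\<close> at 0 for the
  reflected data into \<open>heat_rr = - heat_r\<close> at 1 for \<open>F\<close>, so the boundary
  analysis is carried out at 0 only.\<close>

lemma (in exp_bounded) heat_reflect:
  "exp_bounded.heat (\<lambda>y. F (1 - y)) r t = heat (1 - r) t"
  "exp_bounded.heat_r (\<lambda>y. F (1 - y)) r t = - heat_r (1 - r) t"
  "exp_bounded.heat_rr (\<lambda>y. F (1 - y)) r t = heat_rr (1 - r) t"
proof -
  interpret R: exp_bounded "\<lambda>y. F (1 - y)" "A * exp a" a by (rule exp_bounded_reflect)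
  show "R.heat r t = heat (1 - r) t" "R.heat_r r t = - heat_r (1 - r) t" "R.heat_rr r t = heat_rr (1 - r) t"
    by (simp_all add: R.heat_def heat_def R.heat_r_def heat_r_def R.heat_rr_def heat_rr_def moment_reflect)
qed

section \<open>Behaviour for small times\<close>

context exp_bounded
begin

text \<open>The substitution \<open>y = r + sqrt t * z\<close> moves \<open>t\<close> into the
  argument of \<open>F\<close>, so the weight stays fixed as \<open>t\<close> decreases to
  0.\<close>

lemma heat_eq_expectation:
  assumes t: "t > 0"
  shows "heat r t = (\<integral>z. std_normal_density z * F (r + sqrt t * z) \<partial>lborel)"
proof -
  have "moment 0 r t = sqrt t * (\<integral>z. exp (- z\<^sup>2 / 2) * F (r + sqrt t * z) \<partial>lborel)"
    unfolding moment_def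
    by (subst lborel_integral_real_affine[of "sqrt t" _ r]) (use t in \<open>auto simp: power_mult_distrib\<close>)
  then have "heat r t = (1 / sqrt (2*pi)) * (\<integral>z. exp (- z\<^sup>2 / 2) * F (r + sqrt t * z) \<partial>lborel)"
    using t by (simp add: heat_def real_sqrt_mult)
  then show ?thesis
    by (simp add: std_normal_density_def mult.assoc flip: integral_mult_right_zero)
qed

lemma integrable_normal_exp: "integrable lborel (\<lambda>z. std_normal_density z * exp (a * \<bar>z\<bar>))"
proof -
  \<comment> \<open>The exponential is itself admissible data, so \<open>gauss_integrable\<close>
    applies to it with \<open>t = 1\<close>, \<open>r = 0\<close>, \<open>k = 0\<close>.\<close>
  interpret E: exp_bounded "\<lambda>y. exp (a * \<bar>y\<bar>)" 1 a
    by standard (use a_nonneg in auto)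
  from E.gauss_integrable[of 1 0 0]
  have "integrable lborel (\<lambda>z. 1 / sqrt (2*pi) * (exp (- z\<^sup>2 / 2) * exp (a * \<bar>z\<bar>)))"
    by simp
  then show ?thesis by (simp add: std_normal_density_def mult.assoc)
qed

lemma F_shift_le:
  assumes "\<bar>s\<bar> \<le> 1"
  shows "\<bar>F (r + s * z)\<bar> \<le> A * exp (a * \<bar>r\<bar>) * exp (a * \<bar>z\<bar>)"
proof -
  have "\<bar>r + s * z\<bar> \<le> \<bar>r\<bar> + \<bar>s * z\<bar>" by (rule abs_triangle_ineq)
  also have "\<bar>s * z\<bar> \<le> \<bar>z\<bar>" using assms by (simp add: abs_mult mult_left_le_one_le)
  finally have "a * \<bar>r + s * z\<bar> \<le> a * \<bar>r\<bar> + a * \<bar>z\<bar>"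
    using a_nonneg by (simp flip: distrib_left add: mult_left_mono)
  then have "A * exp (a * \<bar>r + s * z\<bar>) \<le> A * exp (a * \<bar>r\<bar> + a * \<bar>z\<bar>)"
    using A_nonneg by (intro mult_left_mono) auto
  then show ?thesis
    using F_le[of "r + s * z"] by (simp add: exp_add mult.assoc)
qed

lemma normal_shift_le:
  assumes "\<bar>s\<bar> \<le> 1"
  shows "\<bar>std_normal_density z * F (r + s * z)\<bar>
    \<le> A * exp (a * \<bar>r\<bar>) * (std_normal_density z * exp (a * \<bar>z\<bar>))"
  using mult_left_mono[OF F_shift_le[OF assms, of r z], of "std_normal_density z"]
  by (simp add: abs_mult mult_ac)

lemma integrable_normal_shift:
  assumes "\<bar>s\<bar> \<le> 1"
  shows "integrable lborel (\<lambda>z. std_normal_density z * F (r + s * z))"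
proof (rule Bochner_Integration.integrable_bound)
  show "integrable lborel (\<lambda>z. A * exp (a * \<bar>r\<bar>) * (std_normal_density z * exp (a * \<bar>z\<bar>)))"
    using integrable_normal_exp by simp
  show "AE z in lborel. norm (std_normal_density z * F (r + s * z))
      \<le> norm (A * exp (a * \<bar>r\<bar>) * (std_normal_density z * exp (a * \<bar>z\<bar>)))"
    using normal_shift_le[OF assms, of _ r]
    by (intro AE_I2) (metis abs_ge_self order_trans real_norm_def)
qed auto

text \<open>For times up to 1 the shift satisfies
  \<open>sqrt t * \<bar>z\<bar> \<le> \<bar>z\<bar>\<close>. This short-time bound feeds the
  comparison principle, which then controls all times.\<close>

lemma heat_bounded:
  assumes "\<bar>r\<bar> \<le> R" "0 < t" "t \<le> 1"
  shows "\<bar>heat r t\<bar> \<le> A * exp (a * R) * (\<integral>z. std_normal_density z * exp (a * \<bar>z\<bar>) \<partial>lborel)"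
proof -
  have s: "\<bar>sqrt t\<bar> \<le> 1" using assms by simp
  have "\<bar>heat r t\<bar> \<le> (\<integral>z. \<bar>std_normal_density z * F (r + sqrt t * z)\<bar> \<partial>lborel)"
    unfolding heat_eq_expectation[OF assms(2)] by (rule integral_abs_bound)
  also have "\<dots> \<le> (\<integral>z. A * exp (a * \<bar>r\<bar>) * (std_normal_density z * exp (a * \<bar>z\<bar>)) \<partial>lborel)"
    using integrable_normal_shift[OF s] integrable_normal_exp normal_shift_le[OF s]
    by (intro integral_mono) auto
  also have "\<dots> = A * exp (a * \<bar>r\<bar>) * (\<integral>z. std_normal_density z * exp (a * \<bar>z\<bar>) \<partial>lborel)"
    by simp
  also have "\<dots> \<le> A * exp (a * R) * (\<integral>z. std_normal_density z * exp (a * \<bar>z\<bar>) \<partial>lborel)"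
    using assms A_nonneg a_nonneg
    by (intro mult_right_mono mult_left_mono integral_nonneg_AE) (auto intro!: mult_left_mono)
  finally show ?thesis .
qed

(* Only the symmetric average has to converge: at the boundary points F itself may oscillate. *)
lemma heat_tendsto:
  assumes lim: "((\<lambda>y. (F (r + y) + F (r - y)) / 2) \<longlongrightarrow> l) (at_right 0)"
  shows "(heat r \<longlongrightarrow> l) (at_right 0)"
proof -
  \<comment> \<open>Averaging over \<open>z\<close> and \<open>- z\<close>, which leaves the normal
    density unchanged, brings in the symmetric mean.\<close>
  have sym: "heat r t = (\<integral>z. std_normal_density z * ((F (r + sqrt t * z) + F (r - sqrt t * z)) / 2) \<partial>lborel)"
    if t: "0 < t" "t < 1" for t
  proof -
    have s: "\<bar>sqrt t\<bar> \<le> 1" "\<bar>- sqrt t\<bar> \<le> 1" using t by simp_all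
    have i: "integrable lborel (\<lambda>z. std_normal_density z * F (r + sqrt t * z))"
      "integrable lborel (\<lambda>z. std_normal_density z * F (r - sqrt t * z))"
      using integrable_normal_shift[OF s(1)] integrable_normal_shift[OF s(2)] by simp_all
    have "heat r t = (\<integral>z. std_normal_density z * F (r - sqrt t * z) \<partial>lborel)"
      unfolding heat_eq_expectation[OF t(1)]
      by (subst lborel_integral_real_affine[of "-1" _ 0]) (auto simp: std_normal_density_def)
    then have "heat r t = ((\<integral>z. std_normal_density z * F (r + sqrt t * z) \<partial>lborel)
       + (\<integral>z. std_normal_density z * F (r - sqrt t * z) \<partial>lborel)) / 2"
      using heat_eq_expectation[OF t(1), of r] by simp
    also have "\<dots> = (\<integral>z. (std_normal_density z * F (r + sqrt t * z) + std_normal_density z * F (r - sqrt t * z)) / 2 \<partial>lborel)"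
      using i by simp
    finally show ?thesis by (simp add: distrib_left)
  qed
  have "((\<lambda>t. \<integral>z. std_normal_density z * ((F (r + sqrt t * z) + F (r - sqrt t * z)) / 2) \<partial>lborel)
      \<longlongrightarrow> (\<integral>z. std_normal_density z * l \<partial>lborel)) (at 0 within {0<..<1})"
  proof (rule integral_dominated_convergence_within[where
        h="\<lambda>z. A * exp (a * \<bar>r\<bar>) * (std_normal_density z * exp (a * \<bar>z\<bar>))"])
    show "\<bar>std_normal_density z * ((F (r + sqrt t * z) + F (r - sqrt t * z)) / 2)\<bar>
        \<le> A * exp (a * \<bar>r\<bar>) * (std_normal_density z * exp (a * \<bar>z\<bar>))"
      if "t \<in> {0<..<1}" for t z
      using normal_shift_le[of "sqrt t" z r] normal_shift_le[of "- sqrt t" z r] that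
      by (auto simp: distrib_left)
    \<comment> \<open>The mean is even in \<open>z\<close>, so \<open>\<bar>z\<bar>\<close> may
      replace \<open>z\<close>; for \<open>z \<noteq> 0\<close> the argument
      \<open>sqrt t * \<bar>z\<bar>\<close> approaches 0 strictly from the right.\<close>
    have lim': "((\<lambda>t. (F (r + sqrt t * z) + F (r - sqrt t * z)) / 2) \<longlongrightarrow> l) (at_right 0)" if "z \<noteq> 0" for z
    proof -
      have "filterlim (\<lambda>t. sqrt t * \<bar>z\<bar>) (at_right 0) (at_right 0)"
        unfolding filterlim_at using that
        by (auto intro!: tendsto_eq_intros simp: eventually_at_filter)
      from filterlim_compose[OF lim this] show ?thesis
        by (cases "z \<ge> 0") (simp_all add: add.commute)
    qed
    have "AE z in lborel. z \<noteq> (0::real)" by (rule AE_lborel_singleton)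
    then show "AE z in lborel. ((\<lambda>t. std_normal_density z * ((F (r + sqrt t * z) + F (r - sqrt t * z)) / 2))
        \<longlongrightarrow> std_normal_density z * l) (at 0 within {0<..<1})"
      by eventually_elim
        (intro tendsto_mult tendsto_const tendsto_within_subset[OF lim'], auto)
  qed (use integrable_normal_exp in auto)
  also have "(\<integral>z. std_normal_density z * l \<partial>lborel) = l"
    by simp
  also have "at (0::real) within {0<..<1} = at_right 0"
    by (rule at_within_nhd[where S="{-1<..<1}"]) auto
  finally have "((\<lambda>t. \<integral>z. std_normal_density z * ((F (r + sqrt t * z) + F (r - sqrt t * z)) / 2) \<partial>lborel)
      \<longlongrightarrow> l) (at_right 0)" .
  moreover have "\<forall>\<^sub>F t in at_right 0.
      (\<integral>z. std_normal_density z * ((F (r + sqrt t * z) + F (r - sqrt t * z)) / 2) \<partial>lborel) = heat r t"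
    using eventually_at_right_real[OF zero_less_one] by eventually_elim (simp add: sym)
  ultimately show ?thesis by (rule Lim_transform_eventually)
qed

end

subsection \<open>Reflection at the boundary\<close>

lemma measurable_bounded_imp_integrable_on:
  fixes f :: "real \<Rightarrow> real"
  assumes "f \<in> borel_measurable borel" "\<And>x. x \<in> {b..c} \<Longrightarrow> \<bar>f x\<bar> \<le> K"
  shows "f integrable_on {b..c}"
proof (rule measurable_bounded_by_integrable_imp_integrable[where g="\<lambda>_. K"])
  show "f \<in> borel_measurable (lebesgue_on {b..c})"
    using assms(1) by (intro measurable_restrict_space1 measurable_completion) simp
qed (use assms(2) in auto)

text \<open>Variation of constants for \<open>h' = 2 * F - h\<close> with
  \<open>h 0 = 2 * v\<close>; this is the value prescribed for \<open>F y + F (- y)\<close>.\<close>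

definition reflection_sum :: "real \<Rightarrow> (real \<Rightarrow> real) \<Rightarrow> real \<Rightarrow> real" where
  "reflection_sum v F y = 2 * exp (- y) * (v + integral {0..y} (\<lambda>s. exp s * F s))"

context exp_bounded
begin

lemma exp_F_integrable_on: "(\<lambda>s. exp s * F s) integrable_on {b..c}"
proof (rule measurable_bounded_imp_integrable_on)
  show "\<bar>exp x * F x\<bar> \<le> exp c * (A * exp (a * (\<bar>b\<bar> + \<bar>c\<bar>)))" if "x \<in> {b..c}" for x
  proof -
    have "A * exp (a * \<bar>x\<bar>) \<le> A * exp (a * (\<bar>b\<bar> + \<bar>c\<bar>))"
      using that A_nonneg a_nonneg by (intro mult_left_mono iffD2[OF exp_le_cancel_iff]) auto
    then have "\<bar>F x\<bar> \<le> A * exp (a * (\<bar>b\<bar> + \<bar>c\<bar>))"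
      using F_le[of x] by linarith
    then show ?thesis
      unfolding abs_mult using that by (intro mult_mono) auto
  qed
qed simp

lemma continuous_on_reflection_sum: "continuous_on {0..c} (reflection_sum v F)"
  unfolding reflection_sum_def
  by (intro continuous_intros indefinite_integral_continuous_1 exp_F_integrable_on)

lemma DERIV_reflection_sum:
  assumes "y > 0" "isCont F y"
  shows "(reflection_sum v F has_real_derivative 2 * F y - reflection_sum v F y) (at y)"
proof -
  have "((\<lambda>y. integral {0..y} (\<lambda>s. exp s * F s)) has_real_derivative exp y * F y) (at y within {0..y + 1})"
    using integral_has_vector_derivative_continuous_at[OF exp_F_integrable_on[of 0 "y + 1"], of y "{}"] assms
    by (simp add: has_real_derivative_iff_has_vector_derivative continuous_at_imp_continuous_at_within
        continuous_intros)
  then have *: "((\<lambda>y. integral {0..y} (\<lambda>s. exp s * F s)) has_real_derivative exp y * F y) (at y)"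
    using assms(1) by (simp add: at_within_Icc_at)
  show ?thesis
    unfolding reflection_sum_def[abs_def]
    by (rule derivative_eq_intros * refl | simp)+ (simp add: algebra_simps flip: exp_add)
qed

text \<open>The integral is at most \<open>(exp y - 1) * K\<close>, and the missing \<open>K\<close>
  makes room for \<open>v\<close>; the factor \<open>exp (- y)\<close> cancels the growth.
  Subtracting \<open>F y\<close> then bounds the reflected value by \<open>3 * K\<close>.\<close>

lemma reflection_sum_le:
  assumes "0 \<le> y" "\<bar>v\<bar> \<le> 1" "1 \<le> K" "\<And>s. 0 \<le> s \<Longrightarrow> s \<le> y \<Longrightarrow> \<bar>F s\<bar> \<le> K"
  shows "\<bar>reflection_sum v F y\<bar> \<le> 2 * K"
proof -
  have e: "((\<lambda>s. exp s * K) has_integral exp y * K - exp 0 * K) {0..y}"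
    using assms(1)
    by (intro fundamental_theorem_of_calculus)
       (auto intro!: derivative_eq_intros simp flip: has_real_derivative_iff_has_vector_derivative)
  have "norm (integral {0..y} (\<lambda>s. exp s * F s)) \<le> integral {0..y} (\<lambda>s. exp s * K)"
    using assms(4) e
    by (intro integral_norm_bound_integral exp_F_integrable_on) (auto simp: abs_mult integrable_on_def)
  then have "\<bar>integral {0..y} (\<lambda>s. exp s * F s)\<bar> \<le> exp y * K - K"
    using integral_unique[OF e] by simp
  then have "\<bar>v + integral {0..y} (\<lambda>s. exp s * F s)\<bar> \<le> exp y * K"
    using assms(2,3) by linarith
  then have "2 * exp (- y) * \<bar>v + integral {0..y} (\<lambda>s. exp s * F s)\<bar> \<le> 2 * exp (- y) * (exp y * K)"
    by (intro mult_left_mono) auto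
  then show ?thesis
    by (simp add: reflection_sum_def abs_mult exp_minus field_simps)
qed

(* With g the Gaussian of variance t and h y = F y + F (- y), the integrand defining
   u_rr - u_r at 0 symmetrises to (g' h)', because 2 F = h' + h. *)
lemma heat_boundary:
  assumes cont: "\<And>x. x \<notin> \<int> \<Longrightarrow> isCont F x"
    and refl: "\<And>y. y > 0 \<Longrightarrow> F (- y) = reflection_sum v F y - F y"
    and t: "t > 0"
  shows "heat_rr 0 t = heat_r 0 t"
proof -
  define g where "g = (\<lambda>y::real. exp (- y\<^sup>2 / (2*t)))"
  define h where "h = reflection_sum v F"
  \<comment> \<open>\<open>J\<close> is the integrand of
    \<open>sqrt (2 * pi * t) * (heat_rr 0 t - heat_r 0 t)\<close>, and \<open>P\<close> below is
    \<open>g' * h\<close>.\<close>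
  define J where "J y = (y\<^sup>2 / t\<^sup>2 - 1 / t - y / t) * g y * F y" for y
  define P where "P y = - (y / t) * g y * h y" for y
  define G where "G k y = (0 - y)^k * exp (- (0 - y)\<^sup>2 / (2*t)) * F y" for k y
  have G: "integrable lborel (G k)" "(\<integral>y. G k y \<partial>lborel) = moment k 0 t" for k
    unfolding G_def[abs_def] moment_def using gauss_integrable[OF t] by blast+
  have J_eq: "J = (\<lambda>y. G 2 y / t\<^sup>2 - G 0 y / t + G 1 y / t)"
    by (simp add: fun_eq_iff J_def g_def G_def algebra_simps diff_divide_distrib)
  have J_int: "integrable lborel J"
    unfolding J_eq using G(1) by simp
  have "(\<integral>y. J y \<partial>lborel) = moment 2 0 t / t\<^sup>2 - moment 0 0 t / t + moment 1 0 t / t"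
    unfolding J_eq using G by simp
  then have diff: "heat_rr 0 t - heat_r 0 t = (\<integral>y. J y \<partial>lborel) / sqrt (2 * pi * t)"
    by (simp add: heat_rr_def heat_r_def add_divide_distrib diff_divide_distrib)
  have J_set: "set_integrable lborel {b..c} J" for b c
    unfolding set_integrable_def using J_int by (intro integrable_mult_indicator) auto
  have J_on: "J integrable_on {b..c}" for b c
    by (rule set_borel_integral_eq_integral(1)[OF J_set])
  have Pn: "(LINT y:{-real n..real n}|lborel. J y) = P (real n)" for n
  proof -
    have "((\<lambda>y. J y + J (- y)) has_integral P (real n) - P 0) {0..real n}"
    \<comment> \<open>\<open>F\<close> may jump at the integers; since \<open>P\<close> is
      continuous, finitely many exceptional points are admissible.\<close>
    proof (rule fundamental_theorem_of_calculus_interior_strong[where S="\<int> \<inter> {0..real n}"])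
      show "finite (\<int> \<inter> {0..real n})"
        using finite_int_segment[of 0 "real n"] by (rule rev_finite_subset) auto
      have "continuous_on {0..real n} (reflection_sum v F)"
        by (rule continuous_on_reflection_sum)
      then show "continuous_on {0..real n} P"
        unfolding P_def[abs_def] g_def h_def using t by (intro continuous_intros) auto
      show "(P has_vector_derivative J y + J (- y)) (at y)"
        if y: "y \<in> {0<..<real n} - \<int> \<inter> {0..real n}" for y
      proof -
        have "y > 0" "isCont F y" using y by (auto intro!: cont)
        then have dh: "(h has_real_derivative 2 * F y - h y) (at y)"
          unfolding h_def by (rule DERIV_reflection_sum)
        have dg: "(g has_real_derivative - (y / t) * g y) (at y)"
          unfolding g_def using t by (auto intro!: derivative_eq_intros simp: field_simps)
        have "(P has_real_derivative (- (1 / t) * g y + - (y / t) * g y * - (y / t)) * h y + (2 * F y - h y) * (- (y / t) * g y)) (at y)"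
          unfolding P_def[abs_def]
          using t by (intro DERIV_mult dg dh) (auto intro!: derivative_eq_intros)
        \<comment> \<open>The even coefficient in \<open>J\<close> pairs with
          \<open>F y + F (- y) = h y\<close>, the odd one with
          \<open>F y - F (- y) = 2 * F y - h y\<close>, which is the derivative of
          \<open>h\<close>.\<close>
        also have "(- (1 / t) * g y + - (y / t) * g y * - (y / t)) * h y + (2 * F y - h y) * (- (y / t) * g y) = J y + J (- y)"
        proof -
          have "g (- y) = g y" "h y = F y + F (- y)"
            using refl[OF \<open>y > 0\<close>] by (simp_all add: g_def h_def)
          then show ?thesis
            using t by (simp add: J_def field_simps power2_eq_square)
        qed
        finally show ?thesis by (simp add: has_real_derivative_iff_has_vector_derivative)
      qed
    qed auto
    then have 1: "integral {0..real n} (\<lambda>y. J y + J (- y)) = P (real n)"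
      by (simp add: integral_unique P_def)
    have "integral {-real n..real n} J = integral {-real n..0} J + integral {0..real n} J"
      by (intro Henstock_Kurzweil_Integration.integral_combine[symmetric] J_on) auto
    also have "integral {-real n..0} J = integral {0..real n} (\<lambda>y. J (- y))"
      using Henstock_Kurzweil_Integration.integral_reflect_real[where a="- real n" and b=0 and f=J]
      by simp
    also have "\<dots> + integral {0..real n} J = integral {0..real n} (\<lambda>y. J y + J (- y))"
      using J_on[of "-real n" 0] J_on[of 0 "real n"] 
        Henstock_Kurzweil_Integration.integrable_reflect_real[where f=J and a="- real n" and b=0]
      by (subst Henstock_Kurzweil_Integration.integral_add) auto
    finally show ?thesis
      using 1 set_borel_integral_eq_integral(2)[OF J_set] by simp
  qed
  \<comment> \<open>The symmetric integrals converge to the full one, while their values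
    \<open>P (real n)\<close> tend to 0 by \<open>gauss_bound\<close> with
    \<open>k = 1\<close>.\<close>
  have "(\<lambda>n. P (real n)) \<longlonglongrightarrow> (\<integral>y. J y \<partial>lborel)"
    unfolding Pn[symmetric] set_lebesgue_integral_def
  proof (rule integral_dominated_convergence[where w="\<lambda>y. norm (J y)"])
    show "AE y in lborel. (\<lambda>n. indicator {-real n..real n} y *\<^sub>R J y) \<longlonglongrightarrow> J y"
    proof (rule AE_I2, rule tendsto_eventually)
      fix y :: real
      obtain N :: nat where "\<bar>y\<bar> \<le> real N" using real_arch_simple by blast
      then show "\<forall>\<^sub>F n in sequentially. indicator {-real n..real n} y *\<^sub>R J y = J y"
        by (intro eventually_sequentiallyI[of N]) (auto simp: indicator_def)
    qed
  qed (use J_int in \<open>auto split: split_indicator\<close>)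
  moreover have "(\<lambda>n. P (real n)) \<longlonglongrightarrow> 0"
  proof (rule Lim_null_comparison)
    define C where "C = A * exp ((a + 1) * 0 + t * (a + 1 + 1)\<^sup>2 / 2)"
    show "\<forall>\<^sub>F n in sequentially. norm (P (real n)) \<le> 2 * C / t * exp (- real n)"
    proof (rule eventually_sequentiallyI[of 1])
      fix n :: nat
      assume "1 \<le> n"
      then have "h (real n) = F (real n) + F (- real n)"
        using refl[of "real n"] by (simp add: h_def)
      then have "P (real n) = - ((real n * g (real n) * F (real n) + real n * g (real n) * F (- real n)) / t)"
        using t by (simp add: P_def field_simps)
      then have "norm (P (real n)) = \<bar>real n * g (real n) * F (real n) + real n * g (real n) * F (- real n)\<bar> / t"
        by (simp only: real_norm_def abs_minus_cancel abs_divide abs_of_pos[OF t])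
      also have "\<dots> \<le> (C * exp (- real n) + C * exp (- real n)) / t"
      proof (rule divide_right_mono[OF order_trans[OF abs_triangle_ineq add_mono]])
        show "\<bar>real n * g (real n) * F (real n)\<bar> \<le> C * exp (- real n)"
          using gauss_bound[of 0 0 t t "real n" 1] t by (simp add: C_def g_def abs_mult)
        show "\<bar>real n * g (real n) * F (- real n)\<bar> \<le> C * exp (- real n)"
          using gauss_bound[of 0 0 t t "- real n" 1] t by (simp add: C_def g_def abs_mult)
      qed (use t in simp)
      finally show "norm (P (real n)) \<le> 2 * C / t * exp (- real n)" by simp
    qed
    have "(\<lambda>n. exp (- real n)) \<longlonglongrightarrow> 0"
      by (rule filterlim_compose[OF exp_at_bot filterlim_compose[OF filterlim_uminus_at_bot_at_top filterlim_real_sequentially]])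
    then show "(\<lambda>n. 2 * C / t * exp (- real n)) \<longlonglongrightarrow> 0"
      by (rule tendsto_mult_right_zero)
  qed
  ultimately have "(\<integral>y. J y \<partial>lborel) = 0" by (rule LIMSEQ_unique)
  then show ?thesis using diff by simp
qed

text \<open>The symmetric mean of \<open>F\<close> at 0 is half of
  \<open>reflection_sum v F\<close>, which is continuous up to 0 with value \<open>2 * v\<close>
  there, even if \<open>F\<close> oscillates.\<close>

lemma heat_boundary_tendsto:
  assumes refl: "\<And>y. y > 0 \<Longrightarrow> F (- y) = reflection_sum v F y - F y"
  shows "(heat 0 \<longlongrightarrow> v) (at_right 0)"
proof (rule heat_tendsto)
  have "(reflection_sum v F \<longlongrightarrow> reflection_sum v F 0) (at 0 within {0..1})"
    using continuous_on_reflection_sum[of 1 v] by (simp add: continuous_on)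
  then have "(reflection_sum v F \<longlongrightarrow> 2 * v) (at_right 0)"
    by (simp add: reflection_sum_def at_within_Icc_at_right)
  then have "((\<lambda>y. reflection_sum v F y / 2) \<longlongrightarrow> 2 * v / 2) (at_right 0)"
    by (intro tendsto_divide tendsto_const) auto
  moreover have "\<forall>\<^sub>F y in at_right 0. reflection_sum v F y / 2 = (F (0 + y) + F (0 - y)) / 2"
    using eventually_at_right_less[of 0] by eventually_elim (simp add: refl)
  ultimately show "((\<lambda>y. (F (0 + y) + F (0 - y)) / 2) \<longlongrightarrow> v) (at_right 0)"
    by (simp add: Lim_transform_eventually)
qed

lemma heat_tendsto_isCont:
  assumes "isCont F r"
  shows "(heat r \<longlongrightarrow> F r) (at_right 0)"
proof (rule heat_tendsto)
  have F: "(F \<longlongrightarrow> F r) (nhds r)" using assms by (simp add: isCont_def tendsto_at_iff_tendsto_nhds)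
  have "((\<lambda>y. F (r + y)) \<longlongrightarrow> F r) (at_right 0)" "((\<lambda>y. F (r - y)) \<longlongrightarrow> F r) (at_right 0)"
    by (rule filterlim_compose[OF F], auto intro!: tendsto_eq_intros)+
  from tendsto_divide[OF tendsto_add[OF this] tendsto_const[of 2]]
  show "((\<lambda>y. (F (r + y) + F (r - y)) / 2) \<longlongrightarrow> F r) (at_right 0)" by simp
qed

end

subsection \<open>Extension of the initial data\<close>

text \<open>\<open>[-n, n + 1]\<close> is the region reached from [0,1] by \<open>n\<close> rounds
  of reflection at both ends, and each round at most triples the bound.\<close>

definition tame :: "(real \<Rightarrow> real) \<Rightarrow> bool" where
  "tame f \<longleftrightarrow> (\<forall>x. x \<notin> \<int> \<longrightarrow> isCont f x) \<and> (\<forall>n. \<forall>x\<in>{-real n..real n + 1}. \<bar>f x\<bar> \<le> 3 ^ n)"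

text \<open>Growth follows from \<open>3 \<le> exp 2\<close>, where rounding
  \<open>\<bar>y\<bar>\<close> up costs the factor \<open>exp 2\<close>; measurability follows from
  continuity off a countable set.\<close>

lemma tame_imp_exp_bounded:
  assumes "tame f"
  shows "exp_bounded f (exp 2) 2"
proof
  have "continuous_on (- \<int>) f"
    using assms by (intro continuous_at_imp_continuous_on) (auto simp: tame_def)
  then show "f \<in> borel_measurable borel"
    by (rule borel_measurable_continuous_countable_exceptions[rotated]) (rule countable_int)
  show "\<bar>f y\<bar> \<le> exp 2 * exp (2 * \<bar>y\<bar>)" for y
  proof -
    define n where "n = nat \<lceil>\<bar>y\<bar>\<rceil>"
    have n: "\<bar>y\<bar> \<le> real n" "real n \<le> \<bar>y\<bar> + 1" unfolding n_def by linarith+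
    then have "y \<in> {- real n..real n + 1}" by auto
    then have "\<bar>f y\<bar> \<le> 3 ^ n" using assms by (simp add: tame_def)
    also have "\<dots> \<le> exp 2 ^ n"
      using exp_ge_add_one_self[of 2] by (intro power_mono) auto
    also have "\<dots> = exp (2 * real n)" by (simp add: exp_of_nat_mult mult.commute)
    also have "\<dots> \<le> exp (2 + 2 * \<bar>y\<bar>)" using n by simp
    finally show ?thesis by (simp add: exp_add)
  qed
qed simp

(* The values at 0 and 1 are immaterial; 0 avoids the uncontrolled values of u0 there. *)
definition reflect_step :: "(real \<Rightarrow> real) \<Rightarrow> real \<Rightarrow> real \<Rightarrow> (real \<Rightarrow> real) \<Rightarrow> real \<Rightarrow> real" where
  "reflect_step u0 v0 v1 f x =
     (if x < 0 then reflection_sum v0 f (- x) - f (- x)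
      else if 1 < x then reflection_sum v1 (\<lambda>s. f (1 - s)) (x - 1) - f (1 - (x - 1))
      else if 0 < x \<and> x < 1 then u0 x else 0)"

text \<open>Locality: the reflected points \<open>- x\<close> and \<open>2 - x\<close>, and the
  points integrated over, lie in the interval that is shorter by one unit at each end.\<close>

lemma reflect_step_cong:
  assumes "\<And>x. - real n \<le> x \<Longrightarrow> x \<le> real n + 1 \<Longrightarrow> f x = g x"
    and "- real (Suc n) \<le> x" "x \<le> real (Suc n) + 1"
  shows "reflect_step u0 v0 v1 f x = reflect_step u0 v0 v1 g x"
proof -
  have "integral {0..- x} (\<lambda>s. exp s * f s) = integral {0..- x} (\<lambda>s. exp s * g s)"
    by (rule Henstock_Kurzweil_Integration.integral_cong) (use assms in auto)
  moreover have "integral {0..x - 1} (\<lambda>s. exp s * f (1 - s)) = integral {0..x - 1} (\<lambda>s. exp s * g (1 - s))"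
    by (rule Henstock_Kurzweil_Integration.integral_cong) (use assms in auto)
  moreover have "f (- x) = g (- x)" if "x < 0" using assms that by auto
  moreover have "f (1 - (x - 1)) = g (1 - (x - 1))" if "x > 1" using assms that by auto
  ultimately show ?thesis
    unfolding reflect_step_def reflection_sum_def by auto
qed

text \<open>Reflection preserves non-integers, hence continuity off the integers, and
  \<open>2 * 3 ^ m + 3 ^ m = 3 ^ Suc m\<close> gives the bound.\<close>

lemma tame_reflect_step:
  assumes u0: "continuous_on {0<..<1} u0" "\<And>x. 0 < x \<Longrightarrow> x < 1 \<Longrightarrow> \<bar>u0 x\<bar> \<le> 1"
    and v: "\<bar>v0\<bar> \<le> 1" "\<bar>v1\<bar> \<le> 1" and f: "tame f"
  shows "tame (reflect_step u0 v0 v1 f)"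
  unfolding tame_def
proof (intro conjI allI impI ballI)
  interpret exp_bounded f "exp 2" 2 by (rule tame_imp_exp_bounded[OF f])
  interpret R: exp_bounded "\<lambda>s. f (1 - s)" "exp 2 * exp 2" 2 by (rule exp_bounded_reflect)
  have cont: "isCont f x" if "x \<notin> \<int>" for x using f that by (simp add: tame_def)
  have bd: "\<bar>f x\<bar> \<le> 3 ^ n" if "- real n \<le> x" "x \<le> real n + 1" for x n using f that by (simp add: tame_def)
  show "isCont (reflect_step u0 v0 v1 f) x" if x: "x \<notin> \<int>" for x
  proof -
    have "x \<noteq> 0" "x \<noteq> 1" using x by auto
    then consider "x < 0" | "x > 1" | "0 < x" "x < 1" by linarith
    then show ?thesis
    proof cases
      case 1
      have x': "isCont f (- x)" using x by (intro cont) simp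
      then have "isCont (reflection_sum v0 f) (- x)"
        using 1 DERIV_reflection_sum[of "- x"] DERIV_isCont by fastforce
      with x' have c: "isCont (\<lambda>x. reflection_sum v0 f (- x) - f (- x)) x"
        by (intro continuous_intros) (auto intro: isCont_o2[where f=uminus])
      have "\<forall>\<^sub>F y in nhds x. reflect_step u0 v0 v1 f y = reflection_sum v0 f (- y) - f (- y)"
        using eventually_nhds_in_open[of "{..<0}" x] 1
        by (auto elim!: eventually_mono simp: reflect_step_def)
      then show ?thesis using c by (simp add: isCont_cong)
    next
      case 2
      have "2 - x \<notin> \<int>" using x Ints_diff[of 2 "2 - x"] by auto
      then have x': "isCont (\<lambda>s. f (1 - s)) (x - 1)"
        using cont[of "2 - x"]
        by (intro isCont_o2[where g=f and f="\<lambda>s. 1 - s"] continuous_intros) (simp add: algebra_simps)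
      then have s: "isCont (reflection_sum v1 (\<lambda>s. f (1 - s))) (x - 1)"
        using 2 R.DERIV_reflection_sum[of "x - 1"] DERIV_isCont by fastforce
      have m: "isCont (\<lambda>x. x - 1) x" by (intro continuous_intros)
      have c: "isCont (\<lambda>x. reflection_sum v1 (\<lambda>s. f (1 - s)) (x - 1) - f (1 - (x - 1))) x"
        by (rule continuous_diff[OF isCont_o2[OF m s] isCont_o2[OF m x']])
      have "\<forall>\<^sub>F y in nhds x. reflect_step u0 v0 v1 f y = reflection_sum v1 (\<lambda>s. f (1 - s)) (y - 1) - f (1 - (y - 1))"
        using eventually_nhds_in_open[of "{1<..}" x] 2
        by (auto elim!: eventually_mono simp: reflect_step_def)
      then show ?thesis using c by (simp add: isCont_cong)
    next
      case 3
      have c: "isCont u0 x" using u0(1) 3 by (simp add: continuous_on_eq_continuous_at)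
      have "\<forall>\<^sub>F y in nhds x. reflect_step u0 v0 v1 f y = u0 y"
        using eventually_nhds_in_open[of "{0<..<1}" x] 3
        by (auto elim!: eventually_mono simp: reflect_step_def)
      then show ?thesis using c by (simp add: isCont_cong)
    qed
  qed
  show "\<bar>reflect_step u0 v0 v1 f x\<bar> \<le> 3 ^ n" if x: "x \<in> {- real n..real n + 1}" for x n
  proof -
    have one: "(1::real) \<le> 3 ^ m" for m by simp
    consider "x < 0" | "x > 1" | "0 \<le> x" "x \<le> 1" by linarith
    then show ?thesis
    proof cases
      case 1
      then obtain m where m: "n = Suc m" using x by (cases n) auto
      have "\<bar>reflection_sum v0 f (- x)\<bar> \<le> 2 * 3 ^ m"
        using x 1 m by (intro reflection_sum_le v one bd) auto
      moreover have "\<bar>f (- x)\<bar> \<le> 3 ^ m" using x 1 m by (intro bd) auto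
      ultimately show ?thesis using 1 m by (simp add: reflect_step_def)
    next
      case 2
      then obtain m where m: "n = Suc m" using x by (cases n) auto
      have "\<bar>reflection_sum v1 (\<lambda>s. f (1 - s)) (x - 1)\<bar> \<le> 2 * 3 ^ m"
        using x 2 m by (intro R.reflection_sum_le v one bd) auto
      moreover have "\<bar>f (1 - (x - 1))\<bar> \<le> 3 ^ m" using x 2 m by (intro bd) auto
      ultimately show ?thesis using 2 m by (simp add: reflect_step_def)
    next
      case 3
      then show ?thesis by (auto simp: reflect_step_def intro!: order_trans[OF u0(2) one])
    qed
  qed
qed

text \<open>By locality the iterates of the zero function stabilise on each interval
  \<open>[-n, n + 1]\<close>; gluing the stable values yields the fixed point.\<close>

lemma reflect_step_fixpoint:
  assumes u0: "continuous_on {0<..<1} u0" "\<And>x. 0 < x \<Longrightarrow> x < 1 \<Longrightarrow> \<bar>u0 x\<bar> \<le> 1"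
    and v: "\<bar>v0\<bar> \<le> 1" "\<bar>v1\<bar> \<le> 1"
  obtains F where "tame F" "reflect_step u0 v0 v1 F = F"
proof -
  define T where "T = reflect_step u0 v0 v1"
  \<comment> \<open>With \<open>Suc n\<close> applications, already \<open>f 0\<close> has its final
    values on [0,1].\<close>
  define f where "f n = (T ^^ Suc n) (\<lambda>_. 0)" for n
  define F where "F x = f (nat \<lceil>\<bar>x\<bar>\<rceil>) x" for x
  have f_Suc: "f (Suc n) = T (f n)" for n by (simp add: f_def)
  have tame_f: "tame (f n)" for n
  proof (induction n)
    case 0
    have "tame (\<lambda>_. 0)" by (simp add: tame_def)
    then show ?case using tame_reflect_step[OF u0 v] by (simp add: f_def T_def)
  next
    case (Suc n)
    then show ?case using tame_reflect_step[OF u0 v] by (simp add: f_Suc T_def)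
  qed
  have f_step: "f (Suc n) x = f n x" if "- real n \<le> x" "x \<le> real n + 1" for n x
    using that
  proof (induction n arbitrary: x)
    case 0
    \<comment> \<open>On [0,1] the value of \<open>reflect_step\<close> does not depend on its
      function argument.\<close>
    then show ?case by (simp add: f_def T_def reflect_step_def)
  next
    case (Suc n)
    show ?case
      unfolding f_Suc[of "Suc n"] f_Suc[of n] T_def
      by (rule reflect_step_cong[OF _ Suc.prems]) (use Suc.IH in \<open>simp add: f_Suc T_def\<close>)
  qed
  have mono: "f m x = f n x" if "n \<le> m" "- real n \<le> x" "x \<le> real n + 1" for m n x
    using that(1)
  proof (induction rule: dec_induct)
    case (step k)
    then show ?case using f_step[of k x] that by simp
  qed simp
  have F_eq: "F x = f n x" if "- real n \<le> x" "x \<le> real n + 1" for n x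
  proof -
    define m where "m = nat \<lceil>\<bar>x\<bar>\<rceil>"
    have "- real m \<le> x" "x \<le> real m + 1" unfolding m_def by linarith+
    then show ?thesis
      unfolding F_def m_def[symmetric]
      using mono[of n m x] mono[of m n x] that by (cases "n \<le> m") auto
  qed
  \<comment> \<open>Strict inequalities give an open neighbourhood, which continuity of
    \<open>F\<close> at \<open>x\<close> requires.\<close>
  have arch: "\<exists>n. - real n < x \<and> x < real n + 1" for x
  proof -
    obtain n where "\<bar>x\<bar> + 1 \<le> real n" using real_arch_simple by blast
    then show ?thesis by (intro exI[of _ n]) linarith
  qed
  have "T F x = F x" for x
  proof -
    obtain n where n: "- real n < x" "x < real n + 1" using arch by blast
    have "T F x = T (f n) x"
      unfolding T_def by (rule reflect_step_cong[of n]) (use F_eq n in auto)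
    also have "\<dots> = F x" using F_eq[of "Suc n" x] n by (simp add: f_Suc)
    finally show ?thesis .
  qed
  moreover have "tame F"
    unfolding tame_def
  proof (intro conjI allI impI ballI)
    fix x :: real
    assume x: "x \<notin> \<int>"
    obtain n where n: "- real n < x" "x < real n + 1" using arch by blast
    have "\<forall>\<^sub>F y in nhds x. F y = f n y"
      using eventually_nhds_in_open[of "{- real n<..<real n + 1}" x] n
      by (auto elim!: eventually_mono simp: F_eq)
    then show "isCont F x" using tame_f[of n] x by (simp add: isCont_cong tame_def)
  next
    fix n :: nat and x :: real
    assume "x \<in> {- real n..real n + 1}"
    then show "\<bar>F x\<bar> \<le> 3 ^ n" using tame_f[of n] F_eq[of n x] by (simp add: tame_def)
  qed
  ultimately show ?thesis using that[of F] by (auto simp: T_def fun_eq_iff)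
qed

section \<open>Existence, global bounds and uniqueness\<close>

theorem theorem2p3:
  fixes u0 :: "real \<Rightarrow> real" and v0_minus v0_plus :: real
  assumes "continuous_on {0<..<1} u0"
    and "\<forall>r\<in>{0<..<1}. u0 r \<in> {0..1}"
    and "v0_minus \<in> {0..1}" and "v0_plus \<in> {0..1}"
  shows "\<exists>u. is_bounded_solution u0 v0_minus v0_plus u \<and>
           (\<forall>w. is_bounded_solution u0 v0_minus v0_plus w \<longrightarrow>
                (\<forall>(r, t)\<in>heat_domain. w r t = u r t))"
proof -
  have "\<bar>u0 x\<bar> \<le> 1" if "0 < x" "x < 1" for x using assms(2) that by fastforce
  then obtain F where "tame F" and F_eq: "reflect_step u0 v0_minus v0_plus F = F"
    using reflect_step_fixpoint[OF assms(1), of v0_minus v0_plus] assms(3,4) by auto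
  interpret exp_bounded F "exp 2" 2 by (rule tame_imp_exp_bounded[OF \<open>tame F\<close>])
  interpret R: exp_bounded "\<lambda>s. F (1 - s)" "exp 2 * exp 2" 2 by (rule exp_bounded_reflect)
  have cont: "isCont F x" if "x \<notin> \<int>" for x
    using \<open>tame F\<close> that by (simp add: tame_def)
  have cont_R: "isCont (\<lambda>s. F (1 - s)) x" if "x \<notin> \<int>" for x
  proof -
    have "1 - x \<notin> \<int>" using that Ints_diff[of 1 "1 - x"] by auto
    then have "isCont F (1 - x)" by (rule cont)
    then show ?thesis by (intro isCont_o2[where g=F and f="\<lambda>s. 1 - s"] continuous_intros)
  qed
  have refl: "F (- y) = reflection_sum v0_minus F y - F y" if "y > 0" for y
    using fun_cong[OF F_eq, of "- y"] that by (simp add: reflect_step_def)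
  \<comment> \<open>The left side is the reflected function at \<open>- y\<close>, so this is the
    reflection hypothesis for the instance \<open>R\<close>.\<close>
  have refl_R: "F (1 - (- y)) = reflection_sum v0_plus (\<lambda>s. F (1 - s)) y - F (1 - y)" if "y > 0" for y
    using fun_cong[OF F_eq, of "1 + y"] that by (simp add: reflect_step_def)
  have F_u0: "F r = u0 r" if "0 < r" "r < 1" for r
    using fun_cong[OF F_eq, of r] that by (simp add: reflect_step_def)
  have sub: "heat_domain \<subseteq> UNIV \<times> {0<..}" by (auto simp: heat_domain_def)
  \<comment> \<open>Taking half of \<open>heat_rr\<close> as time derivative up to the boundary
    reduces the dynamic conditions to \<open>heat_rr = heat_r\<close> at 0 and
    \<open>heat_rr = - heat_r\<close> at 1.\<close>
  have sol: "wentzell_solution heat heat_r heat_rr (\<lambda>r t. 1/2 * heat_rr r t)"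
    unfolding wentzell_solution_def
  proof (intro conjI ballI allI impI)
    show "continuous_on heat_domain (\<lambda>(r, t). heat r t)"
      "continuous_on heat_domain (\<lambda>(r, t). heat_r r t)"
      "continuous_on heat_domain (\<lambda>(r, t). heat_rr r t)"
      using continuous_on_heat sub by (blast intro: continuous_on_subset)+
    then show "continuous_on heat_domain (\<lambda>(r, t). 1/2 * heat_rr r t)"
      unfolding case_prod_unfold by (intro continuous_intros)
    show "1/2 * heat_rr 0 t = 1/2 * heat_r 0 t" if "t > 0" for t
      using heat_boundary[OF cont refl that] by simp
    show "1/2 * heat_rr 1 t = - (1/2) * heat_r 1 t" if "t > 0" for t
      using R.heat_boundary[OF cont_R refl_R that] by (simp add: heat_reflect)
    fix r t :: real
    assume "t > 0"
    then show "((\<lambda>x. heat x t) has_real_derivative heat_r r t) (at r within {0..1})"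
      "((\<lambda>x. heat_r x t) has_real_derivative heat_rr r t) (at r within {0..1})"
      "(heat r has_real_derivative 1/2 * heat_rr r t) (at t)"
      using DERIV_heat has_field_derivative_at_within by blast+
  qed simp
  have lim0: "(heat 0 \<longlongrightarrow> v0_minus) (at_right 0)"
    using heat_boundary_tendsto[OF refl] .
  have lim1: "(heat 1 \<longlongrightarrow> v0_plus) (at_right 0)"
  proof -
    have "R.heat 0 = heat 1" by (simp add: fun_eq_iff heat_reflect)
    then show ?thesis using R.heat_boundary_tendsto[OF refl_R] by simp
  qed
  have lim: "(heat r \<longlongrightarrow> u0 r) (at_right 0)" if "0 < r" "r < 1" for r
  proof -
    have "isCont F r" using that by (intro cont) (auto elim!: Ints_cases)
    then show ?thesis using heat_tendsto_isCont F_u0[OF that] by metis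
  qed
  obtain B where B: "\<bar>heat r t\<bar> \<le> B" if "0 \<le> r" "r \<le> 1" "0 < t" "t \<le> 1" for r t
  proof
    show "\<bar>heat r t\<bar> \<le> exp 2 * exp (2 * 1) * (\<integral>z. std_normal_density z * exp (2 * \<bar>z\<bar>) \<partial>lborel)"
      if "0 \<le> r" "r \<le> 1" "0 < t" "t \<le> 1" for r t
      by (rule heat_bounded) (use that in auto)
  qed
  \<comment> \<open>One function collects the three initial conditions on [0,1], in the form that
    the comparison principle uses.\<close>
  define l where "l r = (if r = 0 then v0_minus else if r = 1 then v0_plus else u0 r)" for r
  have r_cases: "r = 0 \<or> r = 1 \<or> r \<in> {0<..<1}" if "0 \<le> r" "r \<le> 1" for r :: real
    using that by auto
  have l: "l r \<in> {0..1}" if "0 \<le> r" "r \<le> 1" for r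
    using r_cases[OF that] assms(2-4) by (auto simp: l_def)
  have init: "(heat r \<longlongrightarrow> l r) (at_right 0)" if "0 \<le> r" "r \<le> 1" for r
    using r_cases[OF that] lim[of r] lim0 lim1 by (auto simp: l_def)
  \<comment> \<open>Comparison with the constant solutions 1 and 0 turns the short-time bound
    \<open>B\<close> into bounds for all times.\<close>
  have le1: "heat r t \<le> 1" if "0 \<le> r" "r \<le> 1" "0 < t" for r t
  proof -
    have "heat r t - 1 \<le> 0"
    proof (rule wentzell_comparison[OF wentzell_solution_diff[OF sol wentzell_solution_const[of 1]]])
      show "\<bar>heat r t - 1\<bar> \<le> B + 1" if "0 \<le> r" "r \<le> 1" "0 < t" "t \<le> 1" for r t
        using B[OF that] by linarith
      show "\<exists>l\<le>0. ((\<lambda>t. heat r t - 1) \<longlongrightarrow> l) (at_right 0)" if "0 \<le> r" "r \<le> 1" for r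
        using tendsto_diff[OF init[OF that] tendsto_const[of 1]] l[OF that]
        by (intro exI[of _ "l r - 1"]) auto
    qed (use that in auto)
    then show ?thesis by simp
  qed
  have ge0: "heat r t \<ge> 0" if "0 \<le> r" "r \<le> 1" "0 < t" for r t
  proof -
    have "0 - heat r t \<le> 0"
    proof (rule wentzell_comparison[OF wentzell_solution_diff[OF wentzell_solution_const[of 0] sol]])
      show "\<bar>0 - heat r t\<bar> \<le> B" if "0 \<le> r" "r \<le> 1" "0 < t" "t \<le> 1" for r t
        using B[OF that] by linarith
      show "\<exists>l\<le>0. ((\<lambda>t. 0 - heat r t) \<longlongrightarrow> l) (at_right 0)" if "0 \<le> r" "r \<le> 1" for r
        using tendsto_diff[OF tendsto_const[of 0] init[OF that]] l[OF that]
        by (intro exI[of _ "0 - l r"]) auto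
    qed (use that in auto)
    then show ?thesis by simp
  qed
  have "bounded ((\<lambda>(r, t). heat r t) ` heat_domain)"
    unfolding bounded_iff using le1 ge0 by (intro exI[of _ 1]) (auto simp: heat_domain_def)
  with sol lim lim0 lim1 have heat: "is_bounded_solution u0 v0_minus v0_plus heat"
    by (intro wentzell_imp_is_bounded_solution)
  \<comment> \<open>The difference of two solutions has initial limit 0 at every point of [0,1].
    Exchanging the two solutions gives uniqueness.\<close>
  have le: "w r t \<le> w' r t"
    if w: "is_bounded_solution u0 v0_minus v0_plus w" and w': "is_bounded_solution u0 v0_minus v0_plus w'"
      and rt: "(r, t) \<in> heat_domain" for w w' r t
  proof -
    obtain C C' where C: "\<And>r t. (r, t) \<in> heat_domain \<Longrightarrow> \<bar>w r t\<bar> \<le> C"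
      "\<And>r t. (r, t) \<in> heat_domain \<Longrightarrow> \<bar>w' r t\<bar> \<le> C'"
      using w w' unfolding is_bounded_solution_def bounded_iff by fastforce
    have "w r t - w' r t \<le> 0"
    proof (rule wentzell_comparison[OF wentzell_solution_diff[OF
            is_bounded_solution_imp_wentzell[OF w] is_bounded_solution_imp_wentzell[OF w']]])
      show "\<bar>w r t - w' r t\<bar> \<le> C + C'" if "0 \<le> r" "r \<le> 1" "0 < t" "t \<le> 1" for r t
        using C(1)[of r t] C(2)[of r t] that by (simp add: heat_domain_def)
      show "\<exists>l\<le>0. ((\<lambda>t. w r t - w' r t) \<longlongrightarrow> l) (at_right 0)" if "0 \<le> r" "r \<le> 1" for r
      proof -
        have "(w r \<longlongrightarrow> l r) (at_right 0)" "(w' r \<longlongrightarrow> l r) (at_right 0)"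
          using r_cases[OF that] w w' unfolding is_bounded_solution_def Let_def by (auto simp: l_def)
        from tendsto_diff[OF this] show ?thesis by auto
      qed
    qed (use rt in \<open>auto simp: heat_domain_def\<close>)
    then show ?thesis by simp
  qed
  show ?thesis
    using heat le by (blast intro: antisym)
qed

end
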